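(* Let $n\geq 1$ and let $w\in A_\infty^*$ be a strong Muckenhoupt weight on $\mathbb{R}^n$. Then there exists a constant $C>0$, depending only on $n$ and $w$, such that for every locally integrable function $f$ on $\mathbb{R}^n$ and every $\lambda>0$, $$w(\{x\in\mathbb{R}^n: M_nf(x)>\lambda\})\leq C \int_{\mathbb{R}^n} \frac{|f(x)|}{\lambda}\Big(1+\big(\log^+ \tfrac{|f(x)|}{\lambda} \big)^{n-1}\Big) M_n w(x)\, dx.$$
   Context: $\mathfrak R_n$ denotes the family of all (bounded, non-degenerate) rectangles in $\mathbb{R}^n$ with sides parallel to the coordinate axes, and $|S|$ denotes Lebesgue measure. For a locally integrable function $f$ on $\mathbb{R}^n$, the strong maximal function is $$M_nf(x)=\sup_{R\in\mathfrak R_n,\ R\ni x}\frac{1}{|R|}\int_R|f(y)|\,dy,\qquad x\in\mathbb{R}^n.$$ $\log^+t=\max(0,\log t)$, with $\log^+ 0=0$. When $n=1$ the factor $(\log^+ t)^{n-1}$ is read as $1$. A weight $w$ is a non-negative locally integrable function on $\mathbb{R}^n$, and $w(S)=\int_S w(x)\,dx$. For $1<p<\infty$ and $p'=p/(p-1)$, $w$ belongs to the class $A_p^*$ if $$\sup_{R\in\mathfrak R_n}\bigg(\frac{1}{|R|}\int_R w\bigg)\bigg(\frac{1}{|R|}\int_R w^{1-p'}\bigg)^{p-1}<+\infty.$$ The class of strong Muckenhoupt weights is $A_\infty^*=\bigcup_{p>1}A_p^*$. Integrals of non-negative functions take values in $[0,+\infty]$, with the convention $0\cdot\infty=0$. 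*)

theory Defs
  imports "HOL-Analysis.Analysis"
begin

text \<open>Each side may be open, closed or half-open.\<close>
definition rectangles :: "(real ^ 'n) set set" where
  "rectangles = {{x. \<forall>i. x $ i \<in> I i} | I :: 'n \<Rightarrow> real set.
     \<forall>i. is_interval (I i) \<and> bounded (I i) \<and> interior (I i) \<noteq> {}}"

definition locally_integrable :: "(real ^ 'n \<Rightarrow> real) \<Rightarrow> bool" where
  "locally_integrable f \<longleftrightarrow> (\<forall>K. compact K \<longrightarrow> set_integrable lebesgue K f)"

definition average :: "(real ^ 'n) set \<Rightarrow> (real ^ 'n \<Rightarrow> ennreal) \<Rightarrow> ennreal" where
  "average R g = (\<integral>\<^sup>+ y \<in> R. g y \<partial>lebesgue) / emeasure lebesgue R"

definition strong_maximal :: "(real ^ 'n \<Rightarrow> real) \<Rightarrow> real ^ 'n \<Rightarrow> ennreal" where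
  "strong_maximal f x =
     (SUP R \<in> {R \<in> rectangles. x \<in> R}. average R (\<lambda>y. ennreal \<bar>f y\<bar>))"

text \<open>Since \<open>ln 0 = 0\<close> in the library, this gives \<open>log_plus 0 = 0\<close>. In dimension one
  \<open>log_plus t ^ 0 = 1\<close> for every \<open>t\<close>, because \<open>0 ^ 0 = 1\<close>.\<close>
definition log_plus :: "real \<Rightarrow> real" where
  "log_plus t = max 0 (ln t)"

text \<open>Real powers on \<open>[0, \<infinity>]\<close>. The library's \<open>powr\<close> has \<open>0 powr a = 0\<close> also for
  \<open>a < 0\<close>, which would make \<open>w\<^bsup>1 - p'\<^esup>\<close> vanish on the zero set of \<open>w\<close> instead of being
  infinite there.\<close>
definition ennreal_power :: "ennreal \<Rightarrow> real \<Rightarrow> ennreal" where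
  "ennreal_power x a =
     (if a = 0 then 1
      else if x = 0 then (if a < 0 then \<infinity> else 0)
      else if x = \<infinity> then (if a < 0 then 0 else \<infinity>)
      else ennreal (enn2real x powr a))"

definition weight :: "(real ^ 'n \<Rightarrow> real) \<Rightarrow> bool" where
  "weight w \<longleftrightarrow> (\<forall>x. 0 \<le> w x) \<and> locally_integrable w"

definition weighted_measure :: "(real ^ 'n \<Rightarrow> real) \<Rightarrow> (real ^ 'n) set \<Rightarrow> ennreal" where
  "weighted_measure w S = (\<integral>\<^sup>+ x \<in> S. ennreal (w x) \<partial>lebesgue)"

definition strong_A :: "real \<Rightarrow> (real ^ 'n \<Rightarrow> real) set" where
  "strong_A p = {w. weight w \<and>
     (let p' = p / (p - 1) in
       (SUP R \<in> rectangles.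
          average R (\<lambda>x. ennreal (w x)) *
          ennreal_power (average R (\<lambda>x. ennreal_power (ennreal (w x)) (1 - p'))) (p - 1))
       < \<infinity>)}"

definition strong_A_infinity :: "(real ^ 'n \<Rightarrow> real) set" where
  "strong_A_infinity = (\<Union>p \<in> {1<..}. strong_A p)"

end

(*
  Each set where the strong maximal function exceeds a level is a countable union of half-open boxes
  with rational corners on which the average of |f| is at least that level, so it suffices to bound
  w of a finite union of such boxes.  Following Cordoba and Fefferman, go through the boxes by
  decreasing length in one coordinate i and select a box if at most half of it lies in the
  dilates (by 3, in direction i) of those selected before.  The union of the rejected boxes is
  controlled by the dilates because w is doubling on all boxes: a one-dimensional Vitali argument on
  grid cells, iterated over the coordinates, replaces the weighted bound for the strong maximal
  function.  For the selected boxes R, integrals of g = |f|/l over R are dominated by the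
  (n-1)-fold iterated one-dimensional maximal function in the other coordinates on disjoint sets,
  whose integral is controlled by the L (log L)^(n-1) integral of g plus a small multiple of the sum
  of |R|.  This holds for every subfamily; integrating it over the level sets of R -> w(R)/|R|
  introduces the maximal function of w.
*)
theory Submission
  imports Defs
begin

section \<open>Slices, boxes and averages in one coordinate\<close>

text \<open>The exponent n - 1 comes from dilating in one direction only. A large part
  \<open>F\<close> of a selected box that misses the earlier boxes can then be chosen as a cylinder
  in direction \<open>i\<close>, so averaging its indicator over the other n - 1 coordinates already
  gives a constant, at least 1/2. Averages over a side are self-adjoint on the box, so this constant
  is traded for n - 1 averages of g, integrated over \<open>F\<close> alone; every such average
  costs one logarithm.

  On the weighted side the obstacle is that the Muckenhoupt condition speaks of boxes, not of lines,
  so a one-dimensional argument cannot be run line by line. A finite union of boxes is, however,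
  constant across each cell of a finite grid, and a cell times an interval is again a box. The
  constants do not depend on the grid.

  Weighted by w(R)/|R|, the small multiple of the sum of |R| becomes half of the sum of w(R) and is
  moved to the left side; this needs that sum to be finite, hence finite families.\<close>

definition upd :: "real ^ 'n \<Rightarrow> 'n \<Rightarrow> real \<Rightarrow> real ^ 'n" where
  "upd x i t = (\<chi> j. if j = i then t else x $ j)"

lemma upd_nth: "upd x i t $ j = (if j = i then t else x $ j)"
  by (simp add: upd_def)

lemma upd_upd [simp]: "upd (upd x i s) i t = upd x i t"
  by (simp add: upd_def vec_eq_iff)

lemma upd_commute: "i \<noteq> j \<Longrightarrow> upd (upd x i s) j t = upd (upd x j t) i s"
  by (simp add: upd_def vec_eq_iff)

lemma borel_measurable_nth [measurable (raw)]:
  fixes f :: "'a \<Rightarrow> real ^ 'n"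
  assumes "f \<in> borel_measurable M"
  shows "(\<lambda>x. f x $ i) \<in> borel_measurable M"
  using assms by (intro borel_measurable_continuous_on[where f="\<lambda>x. x $ i"] continuous_intros)

lemma borel_measurable_upd [measurable (raw)]:
  fixes f :: "'a \<Rightarrow> real ^ 'n"
  assumes [measurable]: "f \<in> borel_measurable M" "g \<in> borel_measurable M"
  shows "(\<lambda>z. upd (f z) i (g z)) \<in> borel_measurable M"
proof -
  have "continuous_on UNIV (\<lambda>x::(real^'n) \<times> real. upd (fst x) i (snd x))"
    unfolding upd_def continuous_on_vec_lambda
  proof (rule continuous_on_vec_lambda)
    fix j show "continuous_on UNIV (\<lambda>x::(real^'n) \<times> real. if j = i then snd x else fst x $ j)"
      by (cases "j = i") (auto intro!: continuous_intros)
  qed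
  from borel_measurable_continuous_Pair[OF assms this] show ?thesis .
qed

text \<open>Tonelli with coordinate \<open>i\<close> innermost. A point \<open>f\<close> of the
  product over the other basis vectors has an unspecified value at \<open>e\<close>, but
  \<open>upd\<close> overwrites exactly that coordinate.\<close>

lemma nn_integral_lborel_slice:
  fixes i :: "'n::finite"
  defines "e \<equiv> axis i (1::real)"
  assumes [measurable]: "\<phi> \<in> borel_measurable borel"
  shows "integral\<^sup>N lborel \<phi> =
    (\<integral>\<^sup>+f. (\<integral>\<^sup>+t. \<phi> (upd (\<Sum>b\<in>Basis. f b *\<^sub>R b) i t) \<partial>lborel) \<partial>(\<Pi>\<^sub>M b\<in>Basis - {e}. lborel))"
proof -
  define T where "T f = (\<Sum>b\<in>Basis. f b *\<^sub>R b)" for f :: "real^'n \<Rightarrow> real"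
  interpret product_sigma_finite "\<lambda>b::real^'n. lborel :: real measure" by standard
  have e: "e \<in> Basis" by (auto simp: e_def Basis_vec_def)
  have ins: "insert e (Basis - {e}) = Basis" using e by auto
  have T_upd: "T (f(e := t)) = upd (T f) i t" for f t
  proof -
    have inner: "T g \<bullet> b = g b" if "b \<in> Basis" for g b
      unfolding T_def using that by (simp add: inner_sum_left inner_Basis if_distrib cong: if_cong)
    have nth: "T g $ j = g (axis j 1)" for g j
      using inner[of "axis j 1" g] by (auto simp: Basis_vec_def inner_axis)
    show ?thesis by (rule vec_eq_iff[THEN iffD2]) (auto simp: upd_nth nth e_def axis_eq_axis)
  qed
  have Tm [measurable]: "T \<in> borel_measurable (\<Pi>\<^sub>M b\<in>Basis. lborel)"
    unfolding T_def by measurable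
  have Tm': "T \<in> borel_measurable (\<Pi>\<^sub>M b\<in>insert e (Basis - {e}). lborel)"
    using Tm unfolding ins .
  have "integral\<^sup>N lborel \<phi> = (\<integral>\<^sup>+f. \<phi> (T f) \<partial>(\<Pi>\<^sub>M b\<in>Basis. lborel))"
    unfolding T_def by (subst lborel_eq, subst nn_integral_distr) auto
  also have "\<dots> = (\<integral>\<^sup>+f. \<phi> (T f) \<partial>(\<Pi>\<^sub>M b\<in>insert e (Basis - {e}). lborel))"
    by (simp only: ins)
  also have "\<dots> = (\<integral>\<^sup>+f. (\<integral>\<^sup>+t. \<phi> (T (f(e := t))) \<partial>lborel) \<partial>(\<Pi>\<^sub>M b\<in>Basis - {e}. lborel))"
    using measurable_compose[OF Tm', of \<phi> borel] assms(2)
    by (intro product_nn_integral_insert) (simp_all add: insert_Diff_if)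
  finally show ?thesis by (simp add: T_upd T_def[symmetric])
qed

text \<open>Reduces an inequality in n dimensions to the one-dimensional one on every line parallel
  to axis \<open>i\<close>.\<close>

lemma nn_integral_slice_mono:
  fixes \<phi> \<psi> :: "real ^ 'n \<Rightarrow> ennreal"
  assumes "\<phi> \<in> borel_measurable borel" "\<psi> \<in> borel_measurable borel"
    and "\<And>x. (\<integral>\<^sup>+t. \<phi> (upd x i t) \<partial>lborel) \<le> (\<integral>\<^sup>+t. \<psi> (upd x i t) \<partial>lborel)"
  shows "integral\<^sup>N lborel \<phi> \<le> integral\<^sup>N lborel \<psi>"
  using assms by (simp add: nn_integral_lborel_slice[of _ i] nn_integral_mono)

lemma nn_integral_slice_cong:
  fixes \<phi> \<psi> :: "real ^ 'n \<Rightarrow> ennreal"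
  assumes "\<phi> \<in> borel_measurable borel" "\<psi> \<in> borel_measurable borel"
    and "\<And>x. (\<integral>\<^sup>+t. \<phi> (upd x i t) \<partial>lborel) = (\<integral>\<^sup>+t. \<psi> (upd x i t) \<partial>lborel)"
  shows "integral\<^sup>N lborel \<phi> = integral\<^sup>N lborel \<psi>"
  using assms by (simp add: nn_integral_lborel_slice[of _ i])

section \<open>Half-open boxes given by a pair of corners\<close>

type_synonym 'n corners = "(real ^ 'n) \<times> (real ^ 'n)"

text \<open>Half-open, so that membership is decided by comparisons \<open>x $ i < a\<close> with
  the two end points; this is what fits boxes to the grids used for the weighted estimates.\<close>

definition side :: "('n::finite) corners \<Rightarrow> 'n \<Rightarrow> real set" where
  "side p i = {fst p $ i ..< snd p $ i}"

definition len :: "('n::finite) corners \<Rightarrow> 'n \<Rightarrow> real" where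
  "len p i = snd p $ i - fst p $ i"

definition hbox :: "('n::finite) corners \<Rightarrow> (real ^ 'n) set" where
  "hbox p = {x. \<forall>i. x $ i \<in> side p i}"

definition proper :: "('n::finite) corners \<Rightarrow> bool" where
  "proper p \<longleftrightarrow> (\<forall>i. fst p $ i < snd p $ i)"

lemma side_measurable [measurable]: "side p i \<in> sets borel"
  by (simp add: side_def)

lemma hbox_measurable [measurable]: "hbox p \<in> sets borel"
proof -
  have "hbox p = {x \<in> space borel. \<forall>i\<in>UNIV. x $ i \<in> side p i}" by (simp add: hbox_def)
  also have "\<dots> \<in> sets borel" by measurable
  finally show ?thesis .
qed

lemma len_pos: "proper p \<Longrightarrow> 0 < len p i"
  by (simp add: proper_def len_def)

lemma emeasure_side: "proper p \<Longrightarrow> emeasure lborel (side p i) = ennreal (len p i)"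
  by (simp add: side_def len_def proper_def less_imp_le)

lemma emeasure_hbox:
  fixes p :: "('n::finite) corners"
  assumes "proper p"
  shows "emeasure lborel (hbox p) = ennreal (\<Prod>i\<in>UNIV. len p i)"
proof -
  have ab: "\<And>b. b \<in> Basis \<Longrightarrow> fst p \<bullet> b \<le> snd p \<bullet> b"
    using assms by (auto simp: proper_def Basis_vec_def inner_axis less_imp_le)
  have inj: "inj_on (\<lambda>i::'n. axis i (1::real)) UNIV" by (auto simp: inj_on_def axis_eq_axis)
  have B: "(Basis :: (real^'n) set) = (\<lambda>i. axis i 1) ` UNIV" by (auto simp: Basis_vec_def)
  have prod: "(\<Prod>b\<in>Basis. (snd p - fst p) \<bullet> b) = (\<Prod>i\<in>UNIV. len p i)"
    unfolding B by (subst prod.reindex[OF inj]) (simp add: inner_axis len_def)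
  have "box (fst p) (snd p) \<subseteq> hbox p" "hbox p \<subseteq> cbox (fst p) (snd p)"
    by (auto simp: hbox_def side_def mem_box_cart less_imp_le)
  then have "emeasure lborel (box (fst p) (snd p)) \<le> emeasure lborel (hbox p)"
    "emeasure lborel (hbox p) \<le> emeasure lborel (cbox (fst p) (snd p))"
    by (auto intro!: emeasure_mono)
  then show ?thesis
    using emeasure_lborel_box[OF ab] emeasure_lborel_cbox[OF ab] prod by simp
qed

lemma emeasure_hbox_pos: "proper p \<Longrightarrow> emeasure lborel (hbox p) \<noteq> 0"
  by (simp add: emeasure_hbox ennreal_eq_0_iff not_le prod_pos len_pos)

lemma emeasure_hbox_finite: "proper p \<Longrightarrow> emeasure lborel (hbox p) \<noteq> \<infinity>"
  by (simp add: emeasure_hbox)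

section \<open>Averages over one side, their adjoints and their iterates\<close>

definition off :: "('n::finite) corners \<Rightarrow> 'n \<Rightarrow> real ^ 'n \<Rightarrow> ennreal" where
  "off p i x = indicator {x. \<forall>j. j \<noteq> i \<longrightarrow> x $ j \<in> side p j} x"

lemma indicator_hbox_upd: "indicator (hbox p) (upd x i t) = off p i x * indicator (side p i) t"
  by (auto simp: off_def hbox_def upd_nth indicator_def split: if_splits)

text \<open>Taken along the line through \<open>x\<close>, with no restriction on the other
  coordinates; the result is constant in direction \<open>i\<close>.\<close>

definition avg1 :: "('n::finite) corners \<Rightarrow> 'n \<Rightarrow> (real ^ 'n \<Rightarrow> ennreal) \<Rightarrow> real ^ 'n \<Rightarrow> ennreal" where
  "avg1 p i h x = (\<integral>\<^sup>+t. h (upd x i t) * indicator (side p i) t \<partial>lborel) / ennreal (len p i)"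

lemma avg1_measurable [measurable]:
  assumes [measurable]: "h \<in> borel_measurable borel"
  shows "avg1 p i h \<in> borel_measurable borel"
  unfolding avg1_def[abs_def] by measurable

lemma avg1_upd [simp]: "avg1 p i h (upd x i t) = avg1 p i h x"
  by (simp add: avg1_def)

lemma avg1_mono:
  assumes "\<And>t. t \<in> side p i \<Longrightarrow> h (upd x i t) \<le> h' (upd x i t)"
  shows "avg1 p i h x \<le> avg1 p i h' x"
  unfolding avg1_def using assms
  by (intro divide_right_mono_ennreal nn_integral_mono) (auto simp: indicator_def)

lemma avg1_const [simp]: "proper p \<Longrightarrow> avg1 p i (\<lambda>_. c) x = c"
  using len_pos[of p i]
  by (simp add: avg1_def nn_integral_cmult_indicator emeasure_side ennreal_mult_divide_eq)

lemma avg1_add: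
  assumes [measurable]: "h \<in> borel_measurable borel" "h' \<in> borel_measurable borel"
  shows "avg1 p i (\<lambda>x. h x + h' x) x = avg1 p i h x + avg1 p i h' x"
  by (simp add: avg1_def distrib_right nn_integral_add add_divide_distrib_ennreal)

lemma avg1_mult_len:
  assumes "proper p"
  shows "avg1 p i h x * ennreal (len p i) = (\<integral>\<^sup>+t. h (upd x i t) * indicator (side p i) t \<partial>lborel)"
  using len_pos[OF assms, of i] by (simp add: avg1_def ennreal_divide_times ennreal_mult_divide_eq)

text \<open>On each line in direction \<open>i\<close> through the box both sides are the product of
  the line integrals of \<open>u\<close> and \<open>h\<close> over the side, divided by its length.
  So averaging is self-adjoint on the box.\<close>

lemma avg1_adjoint:
  fixes p :: "('n::finite) corners"
  assumes [measurable]: "h \<in> borel_measurable borel" "u \<in> borel_measurable borel" and "proper p"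
  shows "(\<integral>\<^sup>+x. u x * avg1 p i h x * indicator (hbox p) x \<partial>lborel)
       = (\<integral>\<^sup>+x. avg1 p i u x * h x * indicator (hbox p) x \<partial>lborel)"
proof (rule nn_integral_slice_cong[where i=i])
  fix x :: "real^'n"
  define l where "l = ennreal (len p i)"
  have *: "(\<integral>\<^sup>+t. u (upd x i t) * avg1 p i h x * (off p i x * indicator (side p i) t) \<partial>lborel)
     = avg1 p i h x * off p i x * (avg1 p i u x * l)" 
    if [measurable]: "u \<in> borel_measurable borel" for u h
    unfolding l_def avg1_mult_len[OF \<open>proper p\<close>]
    by (subst nn_integral_cmult[symmetric]) (auto intro!: nn_integral_cong simp: mult_ac)
  show "(\<integral>\<^sup>+t. u (upd x i t) * avg1 p i h (upd x i t) * indicator (hbox p) (upd x i t) \<partial>lborel)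
     = (\<integral>\<^sup>+t. avg1 p i u (upd x i t) * h (upd x i t) * indicator (hbox p) (upd x i t) \<partial>lborel)"
    using *[of u h] *[of h u] by (simp add: indicator_hbox_upd mult.commute mult.left_commute)
qed measurable

abbreviation avgs :: "('n::finite) corners \<Rightarrow> 'n list \<Rightarrow> (real ^ 'n \<Rightarrow> ennreal) \<Rightarrow> real ^ 'n \<Rightarrow> ennreal" where
  "avgs p js h \<equiv> foldr (avg1 p) js h"

lemma avgs_measurable [measurable]:
  "h \<in> borel_measurable borel \<Longrightarrow> avgs p js h \<in> borel_measurable borel"
  by (induction js) auto

text \<open>The adjoint of a composition composes the adjoints in the opposite order, hence
  \<open>rev js\<close>.\<close>

lemma avgs_adjoint:
  assumes "h \<in> borel_measurable borel" "u \<in> borel_measurable borel" "proper p"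
  shows "(\<integral>\<^sup>+x. u x * avgs p js h x * indicator (hbox p) x \<partial>lborel)
       = (\<integral>\<^sup>+x. avgs p (rev js) u x * h x * indicator (hbox p) x \<partial>lborel)"
  using assms(2)
proof (induction js arbitrary: u)
  case (Cons j js)
  then show ?case using assms
    by (simp add: avg1_adjoint[of "avgs p js h"] Cons.IH)
qed simp

definition indep :: "'n \<Rightarrow> (real ^ 'n \<Rightarrow> 'a) \<Rightarrow> bool" where
  "indep i h \<longleftrightarrow> (\<forall>x t. h (upd x i t) = h x)"

lemma indep_avg1: "indep i h \<or> i = j \<Longrightarrow> indep i (avg1 p j h)"
  by (cases "i = j") (auto simp: indep_def avg1_def upd_commute[of i j])

lemma indep_avgs: "indep i h \<or> i \<in> set js \<Longrightarrow> indep i (avgs p js h)"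
  by (induction js) (auto intro: indep_avg1)

text \<open>The coordinates of \<open>x\<close> are replaced by those of \<open>y\<close> one at a
  time, along a finite set \<open>A\<close>.\<close>

lemma indep_all_const:
  fixes h :: "real ^ 'n \<Rightarrow> 'a"
  assumes "\<And>i. indep i h"
  shows "h x = h y"
proof -
  have "h (\<chi> j. if j \<in> A then y $ j else x $ j) = h x" if "finite A" for A :: "'n set"
    using that
  proof (induction A)
    case (insert a A)
    have "(\<chi> j. if j \<in> insert a A then y $ j else x $ j)
       = upd (\<chi> j. if j \<in> A then y $ j else x $ j) a (y $ a)"
      by (auto simp: vec_eq_iff upd_nth)
    then show ?case using insert assms[of a] by (simp add: indep_def)
  qed simp
  from this[of UNIV] show ?thesis by simp
qed

lemma avgs_one [simp]: "proper p \<Longrightarrow> avgs p js (\<lambda>_. 1) = (\<lambda>_. 1)"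
  by (induction js) (auto intro!: ext)

lemma nn_integral_avgs:
  assumes "h \<in> borel_measurable borel" "proper p"
  shows "(\<integral>\<^sup>+x. avgs p js h x * indicator (hbox p) x \<partial>lborel)
       = (\<integral>\<^sup>+x. h x * indicator (hbox p) x \<partial>lborel)"
  using avgs_adjoint[of h "\<lambda>_. 1" p js] assms by simp

text \<open>After averaging no coordinate is left to depend on, so the function is constant; its
  value follows because averages preserve the integral over the box. Coordinates on which
  \<open>h\<close> does not depend may be absent from \<open>js\<close>, and this is where one
  dimension is saved.\<close>

lemma avgs_full:
  assumes [measurable]: "h \<in> borel_measurable borel" and "proper p" "\<And>j. indep j h \<or> j \<in> set js"
  shows "avgs p js h x * emeasure lborel (hbox p) = (\<integral>\<^sup>+x. h x * indicator (hbox p) x \<partial>lborel)"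
proof -
  define c where "c = avgs p js h x"
  have "avgs p js h y = c" for y
    unfolding c_def by (rule indep_all_const) (use assms in \<open>auto intro: indep_avgs\<close>)
  then have "(\<integral>\<^sup>+y. avgs p js h y * indicator (hbox p) y \<partial>lborel) = c * emeasure lborel (hbox p)"
    by (simp add: nn_integral_cmult_indicator cong: nn_integral_cong)
  then show ?thesis using nn_integral_avgs[of h p js] assms by (simp add: c_def)
qed

text \<open>One-dimensional maximal function over the sides of \<open>P\<close> only. It is used for
  finite \<open>P\<close>, which gives measurability and lets a greedy Vitali selection
  terminate.\<close>

definition max1 :: "('n::finite) corners set \<Rightarrow> 'n \<Rightarrow> (real ^ 'n \<Rightarrow> ennreal) \<Rightarrow> real ^ 'n \<Rightarrow> ennreal" where
  "max1 P i h x = (SUP p\<in>P. indicator (side p i) (x $ i) * avg1 p i h x)"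

abbreviation maxs :: "('n::finite) corners set \<Rightarrow> 'n list \<Rightarrow> (real ^ 'n \<Rightarrow> ennreal) \<Rightarrow> real ^ 'n \<Rightarrow> ennreal" where
  "maxs P js h \<equiv> foldr (max1 P) js h"

lemma max1_measurable [measurable]:
  assumes [measurable]: "h \<in> borel_measurable borel" and "finite P"
  shows "max1 P i h \<in> borel_measurable borel"
  unfolding max1_def[abs_def] using assms by (intro borel_measurable_SUP countable_finite) measurable

lemma maxs_measurable [measurable]:
  "h \<in> borel_measurable borel \<Longrightarrow> finite P \<Longrightarrow> maxs P js h \<in> borel_measurable borel"
  by (induction js) auto

text \<open>The average over side \<open>j\<close> only sees points \<open>upd x j t\<close> with
  \<open>t\<close> in that side. They stay in the box, so the induction hypothesis applies under the
  integral.\<close>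

lemma avgs_le_maxs:
  assumes "p \<in> P" "x \<in> hbox p"
  shows "avgs p js h x \<le> maxs P js h x"
  using assms(2)
proof (induction js arbitrary: x)
  case (Cons j js)
  have "avg1 p j (avgs p js h) x \<le> avg1 p j (maxs P js h) x"
    by (rule avg1_mono, rule Cons.IH) (use Cons.prems in \<open>auto simp: hbox_def upd_nth\<close>)
  also have "\<dots> = indicator (side p j) (x $ j) * avg1 p j (maxs P js h) x"
    using Cons.prems by (auto simp: hbox_def indicator_def)
  also have "\<dots> \<le> max1 P j (maxs P js h) x"
    unfolding max1_def using assms(1) by (rule SUP_upper)
  finally show ?case by simp
qed simp

section \<open>The iterated one-dimensional maximal function\<close>

definition star :: "('n::finite) corners \<Rightarrow> 'n \<Rightarrow> 'n corners" where
  "star p i = (upd (fst p) i (fst p $ i - len p i), upd (snd p) i (snd p $ i + len p i))"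

lemma side_star: "side (star p i) j =
    (if j = i then {fst p $ i - len p i ..< snd p $ i + len p i} else side p j)"
  by (simp add: side_def star_def upd_nth)

lemma len_star: "len (star p i) j = (if j = i then 3 * len p i else len p j)"
  by (simp add: star_def upd_nth len_def)

lemma proper_star: "proper p \<Longrightarrow> proper (star p i)"
  unfolding proper_def by (auto simp: star_def upd_nth len_def)

lemma side_subset_star: "proper p \<Longrightarrow> side p i \<subseteq> side (star p i) i"
  using len_pos[of p i] unfolding side_star by (auto simp: side_def)

lemma side_star_covers:
  assumes "len q i \<le> len p i" "side q i \<inter> side p i \<noteq> {}"
  shows "side q i \<subseteq> side (star p i) i"
  using assms by (auto simp: side_star) (auto simp: side_def len_def)

text \<open>Greedy finite Vitali selection: keep a longest side, drop all sides that meet it, since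
  its dilate covers them, and recurse on the rest.\<close>

lemma vitali_sides:
  fixes P :: "('n::finite) corners set"
  assumes "finite P" "\<And>p. p \<in> P \<Longrightarrow> proper p"
  shows "\<exists>Q\<subseteq>P. disjoint_family_on (\<lambda>p. side p i) Q \<and>
    (\<Union>p\<in>P. side p i) \<subseteq> (\<Union>p\<in>Q. side (star p i) i)"
  using assms
proof (induction P rule: finite_psubset_induct)
  case (psubset P)
  show ?case
  proof (cases "P = {}")
    case False
    have fin: "finite ((\<lambda>q. len q i) ` P)" "(\<lambda>q. len q i) ` P \<noteq> {}"
      using \<open>finite P\<close> False by auto
    from Max_in[OF fin] obtain p where pm: "p \<in> P" "Max ((\<lambda>q. len q i) ` P) = len p i"
      by (elim imageE)
    have p: "p \<in> P" "\<And>q. q \<in> P \<Longrightarrow> len q i \<le> len p i"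
      using pm(1) Max_ge[OF fin(1)] by (auto simp: pm(2)[symmetric])
    define P' where "P' = {q \<in> P. side q i \<inter> side p i = {}}"
    \<comment> \<open>A proper side is nonempty, hence meets itself, so \<open>p\<close> is dropped
      and \<open>P'\<close> is strictly smaller.\<close>
    have "fst p $ i \<in> side p i" using psubset.prems[OF p(1)] by (simp add: side_def proper_def)
    then have "P' \<subset> P" using p(1) by (auto simp: P'_def)
    then obtain Q where Q: "Q \<subseteq> P'" "disjoint_family_on (\<lambda>p. side p i) Q"
      "(\<Union>p\<in>P'. side p i) \<subseteq> (\<Union>p\<in>Q. side (star p i) i)"
      using psubset.IH[of P'] psubset.prems by (auto simp: P'_def)
    have "side q i \<subseteq> (\<Union>p\<in>insert p Q. side (star p i) i)" if "q \<in> P" for q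
    proof (cases "q \<in> P'")
      case True then show ?thesis using Q(3) by auto
    next
      case False
      then have "side q i \<subseteq> side (star p i) i"
        using that p(2)[OF that] by (intro side_star_covers) (auto simp: P'_def)
      then show ?thesis by auto
    qed
    moreover have "disjoint_family_on (\<lambda>p. side p i) (insert p Q)"
      using Q(1,2) by (auto simp: disjoint_family_on_def P'_def)
    ultimately show ?thesis
      using Q(1) p(1) by (intro exI[of _ "insert p Q"]) (auto simp: P'_def)
  qed (auto simp: disjoint_family_on_def)
qed

lemma sum_nn_integral_disjoint_le:
  assumes "finite Q" "disjoint_family_on A Q" "\<And>q. q \<in> Q \<Longrightarrow> A q \<in> sets M" "h \<in> borel_measurable M"
  shows "(\<Sum>q\<in>Q. \<integral>\<^sup>+x. h x * indicator (A q) x \<partial>M) \<le> integral\<^sup>N M h"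
proof -
  have "(\<Sum>q\<in>Q. \<integral>\<^sup>+x. h x * indicator (A q) x \<partial>M) = (\<integral>\<^sup>+x. (\<Sum>q\<in>Q. h x * indicator (A q) x) \<partial>M)"
    using assms by (intro nn_integral_sum[symmetric]) auto
  also have "\<dots> = (\<integral>\<^sup>+x. h x * indicator (\<Union>q\<in>Q. A q) x \<partial>M)"
    using assms by (simp add: sum_distrib_left[symmetric] indicator_UN_disjoint)
  also have "\<dots> \<le> integral\<^sup>N M h"
    by (intro nn_integral_mono) (auto simp: indicator_def)
  finally show ?thesis .
qed

lemma max1_gt_iff: "s < max1 P i h x \<longleftrightarrow> (\<exists>p\<in>P. x $ i \<in> side p i \<and> s < avg1 p i h x)"
  by (auto simp: max1_def less_SUP_iff indicator_def)

lemma weak_type_slice: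
  assumes [measurable]: "h \<in> borel_measurable borel" and "finite P" "\<And>p. p \<in> P \<Longrightarrow> proper p"
  shows "s * emeasure lborel {t. s < max1 P i h (upd x i t)} \<le> 3 * (\<integral>\<^sup>+t. h (upd x i t) \<partial>lborel)"
proof -
  \<comment> \<open>The averages do not change along the line, so the level set on it is exactly the
    union of the sides in \<open>J\<close>.\<close>
  define J where "J = {p \<in> P. s < avg1 p i h x}"
  have J: "finite J" "\<And>p. p \<in> J \<Longrightarrow> proper p" using assms by (auto simp: J_def)
  obtain Q where Q: "Q \<subseteq> J" "disjoint_family_on (\<lambda>p. side p i) Q"
      "(\<Union>p\<in>J. side p i) \<subseteq> (\<Union>p\<in>Q. side (star p i) i)"
    using vitali_sides[OF J, of i] by blast
  have finQ: "finite Q" using Q(1) J(1) finite_subset by blast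
  have pr: "proper p" if "p \<in> Q" for p using J(2)[OF subsetD[OF Q(1) that]] .
  have "{t. s < max1 P i h (upd x i t)} = (\<Union>p\<in>J. side p i)"
    by (auto simp: max1_gt_iff upd_nth J_def)
  then have "emeasure lborel {t. s < max1 P i h (upd x i t)} \<le> emeasure lborel (\<Union>p\<in>Q. side (star p i) i)"
    using Q(3) finQ by (simp, intro emeasure_mono) (auto intro!: sets.finite_UN)
  also have "\<dots> \<le> (\<Sum>p\<in>Q. emeasure lborel (side (star p i) i))"
    using finQ by (intro emeasure_subadditive_finite) auto
  also have "\<dots> = (\<Sum>p\<in>Q. 3 * ennreal (len p i))"
    by (intro sum.cong refl) (simp add: emeasure_side proper_star pr len_star ennreal_mult' )
  finally have "s * emeasure lborel {t. s < max1 P i h (upd x i t)} \<le> s * (\<Sum>p\<in>Q. 3 * ennreal (len p i))"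
    by (rule mult_left_mono) simp
  also have "\<dots> = 3 * (\<Sum>p\<in>Q. s * ennreal (len p i))"
    by (simp add: sum_distrib_left mult_ac)
  also have "\<dots> \<le> 3 * (\<Sum>p\<in>Q. \<integral>\<^sup>+t. h (upd x i t) * indicator (side p i) t \<partial>lborel)"
  proof (intro mult_left_mono sum_mono)
    fix p assume p: "p \<in> Q"
    then have "s \<le> avg1 p i h x" using Q(1) by (auto simp: J_def)
    then show "s * ennreal (len p i) \<le> (\<integral>\<^sup>+t. h (upd x i t) * indicator (side p i) t \<partial>lborel)"
      using avg1_mult_len[OF pr[OF p], of i h x] by (metis mult_right_mono zero_le)
  qed simp
  also have "\<dots> \<le> 3 * (\<integral>\<^sup>+t. h (upd x i t) \<partial>lborel)"
    by (intro mult_left_mono sum_nn_integral_disjoint_le finQ Q) auto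
  finally show ?thesis .
qed

text \<open>Values of \<open>h\<close> up to s/2 contribute at most s/2 to an average, so an average
  of \<open>h\<close> above s forces one of the truncation \<open>h'\<close> above s/2. The constant
  is 2 * 3: the bound on lines gives 3, and passing from s to s/2 gives 2.\<close>

lemma weak_type:
  fixes h :: "real ^ 'n \<Rightarrow> ennreal"
  assumes [measurable]: "h \<in> borel_measurable borel" and P: "finite P" "\<And>p. p \<in> P \<Longrightarrow> proper p"
  shows "ennreal s * emeasure lborel {x. ennreal s < max1 P i h x}
    \<le> 6 * (\<integral>\<^sup>+x. h x * indicator {x. ennreal (s / 2) < h x} x \<partial>lborel)"
proof (cases "s > 0")
  case True
  note [measurable] = max1_measurable[OF _ P(1)]
  define h' where "h' = (\<lambda>x. h x * indicator {x. ennreal (s / 2) < h x} x)"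
  have h' [measurable]: "h' \<in> borel_measurable borel" unfolding h'_def by measurable
  have half: "ennreal (s / 2) + ennreal (s / 2) = ennreal s" "2 * ennreal (s / 2) = ennreal s"
    using True ennreal_plus[of "s/2" "s/2"] ennreal_mult[of 2 "s/2"] by auto
  have sub: "ennreal (s / 2) < avg1 p i h' x" if "ennreal s < avg1 p i h x" "p \<in> P" for p x
  proof (rule ccontr)
    assume "\<not> ennreal (s / 2) < avg1 p i h' x"
    moreover have "avg1 p i h x \<le> avg1 p i (\<lambda>x. h' x + ennreal (s / 2)) x"
      by (rule avg1_mono) (auto simp: h'_def indicator_def)
    moreover have "\<dots> = avg1 p i h' x + ennreal (s / 2)"
      using P(2)[OF that(2)] by (subst avg1_add) auto
    ultimately have "avg1 p i h x \<le> ennreal s"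
      by (metis add_right_mono half(1) not_less order_trans)
    with that(1) show False by simp
  qed
  have "(\<integral>\<^sup>+x. ennreal s * indicator {x. ennreal s < max1 P i h x} x \<partial>lborel) \<le> (\<integral>\<^sup>+x. 6 * h' x \<partial>lborel)"
  proof (rule nn_integral_slice_mono[where i=i])
    fix x
    have "(\<integral>\<^sup>+t. ennreal s * indicator {x. ennreal s < max1 P i h x} (upd x i t) \<partial>lborel)
       = (\<integral>\<^sup>+t. ennreal s * indicator {t. ennreal s < max1 P i h (upd x i t)} t \<partial>lborel)"
      by (simp add: indicator_def)
    also have "\<dots> = ennreal s * emeasure lborel {t. ennreal s < max1 P i h (upd x i t)}"
      by (subst nn_integral_cmult_indicator) auto
    also have "\<dots> \<le> ennreal s * emeasure lborel {t. ennreal (s/2) < max1 P i h' (upd x i t)}"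
    proof (intro mult_left_mono emeasure_mono)
      show "{t. ennreal s < max1 P i h (upd x i t)} \<subseteq> {t. ennreal (s/2) < max1 P i h' (upd x i t)}"
        using sub by (auto simp: max1_gt_iff upd_nth)
    qed measurable
    also have "\<dots> = 2 * (ennreal (s/2) * emeasure lborel {t. ennreal (s/2) < max1 P i h' (upd x i t)})"
      by (simp add: half(2) mult.assoc[symmetric])
    also have "\<dots> \<le> 2 * (3 * (\<integral>\<^sup>+t. h' (upd x i t) \<partial>lborel))"
      using P by (intro mult_left_mono weak_type_slice) auto
    also have "\<dots> = (\<integral>\<^sup>+t. 6 * h' (upd x i t) \<partial>lborel)"
      by (simp add: nn_integral_cmult mult.assoc[symmetric])
    finally show "(\<integral>\<^sup>+t. ennreal s * indicator {x. ennreal s < max1 P i h x} (upd x i t) \<partial>lborel)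
      \<le> (\<integral>\<^sup>+t. 6 * h' (upd x i t) \<partial>lborel)" .
  qed measurable
  then show ?thesis
    by (simp add: nn_integral_cmult_indicator nn_integral_cmult h'_def)
qed (simp add: ennreal_neg)

section \<open>Dyadic layers and the L log L estimate\<close>

lemma le_suminf_ennreal: "(f :: nat \<Rightarrow> ennreal) j \<le> suminf f"
  using sum_le_suminf[of f "{j}"] by simp

text \<open>One term suffices if \<open>H\<close> is finite: the last \<open>k\<close> with
  \<open>2 ^ k * s < H\<close> satisfies \<open>H \<le> 2 * (2 ^ k * s)\<close>. If \<open>H\<close>
  is infinite, all indicators are 1 and the terms are unbounded.\<close>

lemma dyadic_bound:
  assumes "s > 0"
  shows "H * indicator {ennreal s<..} H \<le> (\<Sum>j. ennreal (2 * (2 ^ j * s)) * indicator {ennreal (2 ^ j * s)<..} H)"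
    (is "_ \<le> (\<Sum>j. ?a j)")
proof (cases "ennreal s < H")
  case True
  have a: "?a j \<le> (\<Sum>j. ?a j)" for j
    by (rule le_suminf_ennreal)
  show ?thesis
  proof (cases H)
    case (real r)
    obtain m0 where "r / s < 2 ^ m0" using real_arch_pow[of 2 "r / s"] by auto
    then have ex: "r \<le> 2 ^ m0 * s" using assms by (simp add: field_simps)
    define m where "m = (LEAST m. r \<le> 2 ^ m * s)"
    have m: "r \<le> 2 ^ m * s" unfolding m_def by (rule LeastI[of _ m0]) (rule ex)
    have "s < r" using True real assms by (simp add: ennreal_less_iff)
    then have "m \<noteq> 0" using m by (intro notI) simp
    then obtain k where k: "m = Suc k" using not0_implies_Suc by blast
    have "\<not> r \<le> 2 ^ k * s" using not_less_Least[of k "\<lambda>m. r \<le> 2 ^ m * s"] k by (simp add: m_def)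
    then have "ennreal (2 ^ k * s) < H" using real assms by (simp add: ennreal_less_iff)
    then have "H \<le> ?a k" using m k real by (simp add: ennreal_leI mult.assoc)
    then show ?thesis using a[of k] True by simp
  next
    case top
    have "(\<Sum>j. ?a j) = \<infinity>"
    proof (rule ccontr)
      assume "(\<Sum>j. ?a j) \<noteq> \<infinity>"
      then obtain r where r: "0 \<le> r" "(\<Sum>j. ?a j) = ennreal r" by (cases "(\<Sum>j. ?a j)") auto
      obtain j where "r / s < 2 ^ j" using real_arch_pow[of 2 "r / s"] by auto
      then have "r < 2 * (2 ^ j * s)" using assms r(1) by (simp add: field_simps)
      moreover have "ennreal (2 * (2 ^ j * s)) \<le> ennreal r" using a[of j] top r by simp
      ultimately show False using r(1) by (simp add: ennreal_le_iff2)
    qed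
    then show ?thesis by simp
  qed
qed simp

text \<open>The added 1 keeps every power at least 1 and makes a constant factor in the argument
  come out as a constant factor (\<open>Llog_mult_le\<close>), so that constants can be
  absorbed.\<close>

definition Llog :: "real \<Rightarrow> real" where
  "Llog t = 1 + max 0 (ln t)"

lemma Llog_ge_1: "1 \<le> Llog t" by (simp add: Llog_def)

lemma Llog_measurable [measurable (raw)]:
  assumes "f \<in> borel_measurable M"
  shows "(\<lambda>x. Llog (f x)) \<in> borel_measurable M"
  unfolding Llog_def
  by (intro borel_measurable_add borel_measurable_max borel_measurable_ln borel_measurable_const assms)

lemma Llog_mono: "0 < x \<Longrightarrow> x \<le> y \<Longrightarrow> Llog x \<le> Llog y"
  by (simp add: Llog_def max_def)

lemma Llog_mult_le:
  assumes "c \<ge> 1" "0 \<le> u"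
  shows "Llog (c * u) \<le> Llog c * Llog u"
proof (cases "u = 0")
  case False
  with assms have "ln (c * u) = ln c + ln u" "0 \<le> ln c" by (auto simp: ln_mult)
  then show ?thesis
    by (auto simp: Llog_def max_def algebra_simps not_le mult_nonneg_nonneg)
qed (use assms in \<open>simp add: Llog_def\<close>)

lemma Llog_2: "Llog 2 \<le> 2"
  using ln_2_less_1 by (simp add: Llog_def)

text \<open>At most \<open>(d + 2) * Llog u\<close> terms are nonzero, where
  \<open>u = g / s\<close>, and each of them is at most \<open>g * (2 * Llog u) ^ d\<close>.
  Counting the terms is what adds one power of the logarithm.\<close>

lemma dyadic_log_sum:
  assumes "g \<ge> 0" "s > 0"
  shows "(\<Sum>j. ennreal (g * Llog (g / (2 ^ j * s / 2)) ^ d * indicator {2 ^ j * s / 2 / 2 ^ d<..} g))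
    \<le> ennreal ((d + 2) * 2 ^ d) * ennreal (g * Llog (g / s) ^ Suc d * indicator {s / 2 ^ Suc d<..} g)"
proof -
  define u where "u = g / s"
  have u: "u \<ge> 0" "g = u * s" using assms by (auto simp: u_def)
  define J where "J = {j::nat. 2 ^ j * s / 2 / 2 ^ d < g}"
  have Jiff: "j \<in> J \<longleftrightarrow> 2 ^ j < 2 ^ Suc d * u" for j
    using assms by (auto simp: J_def u field_simps)
  \<comment> \<open>The factor 2 stands in for 1 / ln 2; all that matters is
    \<open>2 * ln 2 \<ge> 1\<close>.\<close>
  define B where "B = d + 1 + 2 * max 0 (ln u)"
  have JB: "real j \<le> B" if "j \<in> J" for j
  proof -
    have up: "u > 0" using that u(1) Jiff[of j] by (cases "u = 0") auto
    have "ln (2 ^ j) < ln (2 ^ Suc d * u)" using that up by (subst ln_less_cancel_iff) (auto simp: Jiff)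
    then have "j * ln 2 < (d + 1) * ln 2 + ln u" using up by (simp add: ln_mult ln_realpow algebra_simps)
    moreover have "ln u \<le> (2 * max 0 (ln u)) * ln 2"
    proof -
      have "max 0 (ln u) * 1 \<le> max 0 (ln u) * (2 * ln 2)"
        by (intro mult_left_mono) (use ln2_ge_two_thirds in auto)
      then show ?thesis by simp
    qed
    ultimately have "j * ln 2 < B * ln 2" by (simp add: B_def algebra_simps)
    then show ?thesis by simp
  qed
  have Jsub: "J \<subseteq> {..nat \<lfloor>B\<rfloor>}" using JB by (auto simp: le_nat_floor)
  then have fin: "finite J" by (rule finite_subset) simp
  have "card J \<le> Suc (nat \<lfloor>B\<rfloor>)" using card_mono[OF _ Jsub] by simp
  also have "real (Suc (nat \<lfloor>B\<rfloor>)) \<le> B + 1"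
    by (simp add: B_def)
  also have "B + 1 \<le> (d + 2) * Llog u"
    by (simp add: B_def Llog_def algebra_simps mult_nonneg_nonneg)
  finally have card: "card J \<le> (d + 2) * Llog u" by simp
  define a where "a j = g * Llog (g / (2 ^ j * s / 2)) ^ d * indicator {2 ^ j * s / 2 / 2 ^ d<..} g" for j
  have a_le: "a j \<le> g * (2 * Llog u) ^ d" if "j \<in> J" for j
  proof -
    have up: "u > 0" using that u(1) Jiff[of j] by (cases "u = 0") auto
    have "g / (2 ^ j * s / 2) = 2 * u / 2 ^ j" using assms by (simp add: u field_simps)
    moreover have "Llog (2 * u / 2 ^ j) \<le> Llog (2 * u)"
      using up by (intro Llog_mono) (auto simp: divide_le_eq)
    moreover have "Llog (2 * u) \<le> 2 * Llog u"
      using Llog_mult_le[of 2 u] Llog_2 u(1) Llog_ge_1[of u] mult_right_mono[OF Llog_2, of "Llog u"] by linarith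
    ultimately have "Llog (g / (2 ^ j * s / 2)) \<le> 2 * Llog u" by simp
    then have "Llog (g / (2 ^ j * s / 2)) ^ d \<le> (2 * Llog u) ^ d"
      using Llog_ge_1[of "g / (2 ^ j * s / 2)"] by (intro power_mono) auto
    then show ?thesis using that assms by (simp add: a_def J_def mult_left_mono)
  qed
  have "(\<Sum>j. ennreal (a j)) = (\<Sum>j\<in>J. ennreal (a j))"
    using fin by (rule suminf_finite) (auto simp: a_def J_def)
  also have "\<dots> \<le> (\<Sum>j\<in>J. ennreal (g * (2 * Llog u) ^ d))"
    by (intro sum_mono ennreal_leI a_le)
  also have "\<dots> = ennreal (card J * (g * (2 * Llog u) ^ d))"
    using assms Llog_ge_1[of u] by (simp add: ennreal_mult ennreal_of_nat_eq_real_of_nat)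
  also have "\<dots> \<le> ennreal ((d + 2) * 2 ^ d * (g * Llog u ^ Suc d * indicator {s / 2 ^ Suc d<..} g))"
  proof (cases "J = {}")
    case False
    then obtain j where "j \<in> J" by auto
    have "1 \<le> (2::real) ^ j" by simp
    also have "\<dots> < 2 ^ Suc d * u" using \<open>j \<in> J\<close> Jiff by auto
    finally have "s / 2 ^ Suc d < g" using assms by (simp add: u field_simps)
    moreover have "card J * (g * (2 * Llog u) ^ d) \<le> ((d + 2) * Llog u) * (g * (2 * Llog u) ^ d)"
      using assms Llog_ge_1[of u] by (intro mult_right_mono card) auto
    ultimately show ?thesis by (intro ennreal_leI) (simp add: power_mult_distrib algebra_simps)
  qed simp
  also have "\<dots> = ennreal ((d + 2) * 2 ^ d) * ennreal (g * Llog (g / s) ^ Suc d * indicator {s / 2 ^ Suc d<..} g)"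
    using assms Llog_ge_1[of u] by (subst ennreal_mult[symmetric]) (auto simp: u_def)
  finally show ?thesis unfolding a_def .
qed

text \<open>Induction over the coordinates: the outer maximal function is cut into dyadic layers at
  \<open>2 ^ j * s\<close>, the weak type bound is used in each layer, and then the induction
  hypothesis at level \<open>2 ^ j * s / 2\<close>. Each coordinate costs one logarithm and halves
  the cut-off on \<open>g\<close>. The cut-off is carried along because it leaves only finitely many
  layers at each point. \<open>C\<close> is uniform in \<open>P\<close>.\<close>

lemma maxs_llog:
  fixes js :: "('n::finite) list"
  shows "\<exists>C\<ge>0. \<forall>P g s. finite P \<longrightarrow> (\<forall>p\<in>P. proper p) \<longrightarrow> g \<in> borel_measurable borel \<longrightarrow>
    (\<forall>x::real^'n. 0 \<le> g x) \<longrightarrow> s > 0 \<longrightarrow>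
    (\<integral>\<^sup>+x. maxs P js (\<lambda>x. ennreal (g x)) x * indicator {ennreal s<..} (maxs P js (\<lambda>x. ennreal (g x)) x) \<partial>lborel)
    \<le> ennreal C * (\<integral>\<^sup>+x. ennreal (g x * Llog (g x / s) ^ length js * indicator {s / 2 ^ length js<..} (g x)) \<partial>lborel)"
proof (induction js)
  case Nil
  have "(\<integral>\<^sup>+x. ennreal (g x) * indicator {ennreal s<..} (ennreal (g x)) \<partial>lborel)
    \<le> (\<integral>\<^sup>+x. ennreal (g x * indicator {s<..} (g x)) \<partial>lborel)"
    if "\<forall>x::real^'n. 0 \<le> g x" "s > 0" for g s
    using that by (intro nn_integral_mono) (auto simp: indicator_def ennreal_less_iff)
  then show ?case by (intro exI[of _ 1]) auto
next
  case (Cons i js)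
  define d where "d = length js"
  from Cons obtain C where "C \<ge> 0" and C: "\<And>P g s. finite P \<Longrightarrow> (\<forall>p\<in>P. proper p) \<Longrightarrow> g \<in> borel_measurable borel \<Longrightarrow>
    (\<forall>x::real^'n. 0 \<le> g x) \<Longrightarrow> s > 0 \<Longrightarrow>
    (\<integral>\<^sup>+x. maxs P js (\<lambda>x. ennreal (g x)) x * indicator {ennreal s<..} (maxs P js (\<lambda>x. ennreal (g x)) x) \<partial>lborel)
    \<le> ennreal C * (\<integral>\<^sup>+x. ennreal (g x * Llog (g x / s) ^ d * indicator {s / 2 ^ d<..} (g x)) \<partial>lborel)"
    unfolding d_def by blast
  \<comment> \<open>12 is 2 from \<open>dyadic_bound\<close> times 6 from \<open>weak_type\<close>;
    the last factor is that of \<open>dyadic_log_sum\<close>.\<close>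
  define C' where "C' = 12 * C * ((d + 2) * 2 ^ d)"
  have "C' \<ge> 0" using \<open>C \<ge> 0\<close> by (simp add: C'_def)
  moreover have "(\<integral>\<^sup>+x. maxs P (i # js) (\<lambda>x. ennreal (g x)) x * indicator {ennreal s<..} (maxs P (i # js) (\<lambda>x. ennreal (g x)) x) \<partial>lborel)
    \<le> ennreal C' * (\<integral>\<^sup>+x. ennreal (g x * Llog (g x / s) ^ Suc d * indicator {s / 2 ^ Suc d<..} (g x)) \<partial>lborel)"
    if P: "finite P" "\<forall>p\<in>P. proper p" and g[measurable]: "g \<in> borel_measurable borel"
      and g0: "\<forall>x::real^'n. 0 \<le> g x" and s: "s > 0" for P g s
  proof -
    define h where "h = maxs P js (\<lambda>x. ennreal (g x))"
    have [measurable]: "h \<in> borel_measurable borel" unfolding h_def using P(1) by measurable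
    note [measurable] = max1_measurable[OF _ P(1)]
    define b where "b j x = g x * Llog (g x / (2 ^ j * s / 2)) ^ d * indicator {2 ^ j * s / 2 / 2 ^ d<..} (g x)" for j :: nat and x
    have [measurable]: "b j \<in> borel_measurable borel" for j unfolding b_def by measurable
    have "(\<integral>\<^sup>+x. max1 P i h x * indicator {ennreal s<..} (max1 P i h x) \<partial>lborel)
      \<le> (\<integral>\<^sup>+x. (\<Sum>j. ennreal (2 * (2 ^ j * s)) * indicator {ennreal (2 ^ j * s)<..} (max1 P i h x)) \<partial>lborel)"
      by (intro nn_integral_mono dyadic_bound s)
    also have "\<dots> = (\<Sum>j. \<integral>\<^sup>+x. ennreal (2 * (2 ^ j * s)) * indicator {ennreal (2 ^ j * s)<..} (max1 P i h x) \<partial>lborel)"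
      by (intro nn_integral_suminf) measurable
    also have "\<dots> \<le> (\<Sum>j. 12 * (ennreal C * (\<integral>\<^sup>+x. ennreal (b j x) \<partial>lborel)))"
    proof (intro suminf_le summableI)
      fix j
      define r where "r = 2 ^ j * s"
      have r: "r > 0" using s by (simp add: r_def)
      have "(\<integral>\<^sup>+x. ennreal (2 * r) * indicator {ennreal r<..} (max1 P i h x) \<partial>lborel)
        = (\<integral>\<^sup>+x. ennreal (2 * r) * indicator {x. ennreal r < max1 P i h x} x \<partial>lborel)"
        by (intro nn_integral_cong) (auto simp: indicator_def)
      also have "\<dots> = 2 * (ennreal r * emeasure lborel {x. ennreal r < max1 P i h x})"
        using r by (subst nn_integral_cmult_indicator) (auto simp: ennreal_mult mult.assoc)
      also have "\<dots> \<le> 2 * (6 * (\<integral>\<^sup>+x. h x * indicator {x. ennreal (r / 2) < h x} x \<partial>lborel))"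
        using P by (intro mult_left_mono weak_type) auto
      also have "\<dots> = 12 * (\<integral>\<^sup>+x. h x * indicator {ennreal (r / 2)<..} (h x) \<partial>lborel)"
        by (simp add: mult.assoc[symmetric] indicator_def)
      also have "\<dots> \<le> 12 * (ennreal C * (\<integral>\<^sup>+x. ennreal (b j x) \<partial>lborel))"
        unfolding h_def b_def using C[OF P g g0, of "r / 2"] r
        by (intro mult_left_mono) (auto simp: r_def)
      finally show "(\<integral>\<^sup>+x. ennreal (2 * (2 ^ j * s)) * indicator {ennreal (2 ^ j * s)<..} (max1 P i h x) \<partial>lborel)
        \<le> 12 * (ennreal C * (\<integral>\<^sup>+x. ennreal (b j x) \<partial>lborel))" unfolding r_def .
    qed
    also have "\<dots> = 12 * (ennreal C * (\<integral>\<^sup>+x. (\<Sum>j. ennreal (b j x)) \<partial>lborel))"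
      by (subst nn_integral_suminf) auto
    also have "\<dots> \<le> 12 * (ennreal C * (\<integral>\<^sup>+x. ennreal ((d + 2) * 2 ^ d) *
        ennreal (g x * Llog (g x / s) ^ Suc d * indicator {s / 2 ^ Suc d<..} (g x)) \<partial>lborel))"
      unfolding b_def using g0 s by (intro mult_left_mono nn_integral_mono dyadic_log_sum) auto
    also have "\<dots> = 12 * (ennreal C * (ennreal ((d + 2) * 2 ^ d) * (\<integral>\<^sup>+x. 
        ennreal (g x * Llog (g x / s) ^ Suc d * indicator {s / 2 ^ Suc d<..} (g x)) \<partial>lborel)))"
      by (subst nn_integral_cmult) auto
    also have "\<dots> = ennreal C' * (\<integral>\<^sup>+x. ennreal (g x * Llog (g x / s) ^ Suc d * indicator {s / 2 ^ Suc d<..} (g x)) \<partial>lborel)"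
      using \<open>C \<ge> 0\<close> by (simp add: C'_def ennreal_mult mult.assoc)
    finally show ?thesis by (simp add: h_def)
  qed
  ultimately show ?case unfolding d_def by (intro exI[of _ C']) auto
qed

section \<open>Doubling weights and sets of positive density\<close>

text \<open>A quantitative A-infinity condition on boxes, the only form in which the weight enters
  the selection argument. The case c = 1/3 is doubling under \<open>star\<close>.\<close>

definition ainf :: "(real ^ 'n) measure \<Rightarrow> bool" where
  "ainf N \<longleftrightarrow> sets N = sets borel \<and> (\<forall>p. emeasure N (hbox p) < \<infinity>) \<and>
    (\<forall>c>0. \<exists>D\<ge>0. \<forall>p E. proper p \<longrightarrow> E \<in> sets borel \<longrightarrow> E \<subseteq> hbox p \<longrightarrow>
      ennreal c * emeasure lborel (hbox p) \<le> emeasure lborel E \<longrightarrow>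
      emeasure N (hbox p) \<le> ennreal D * emeasure N E)"

text \<open>\<open>E\<close> is a union of cells of the grid cut out by the hyperplanes
  \<open>x $ i = a\<close> with \<open>(i, a)\<close> in \<open>H\<close>.\<close>

definition grid_invariant :: "('n \<times> real) set \<Rightarrow> (real ^ 'n) set \<Rightarrow> bool" where
  "grid_invariant H E \<longleftrightarrow>
    (\<forall>x y. (\<forall>z\<in>H. x $ fst z < snd z \<longleftrightarrow> y $ fst z < snd z) \<longrightarrow> (x \<in> E \<longleftrightarrow> y \<in> E))"

lemma grid_invariant_mono: "grid_invariant H E \<Longrightarrow> H \<subseteq> H' \<Longrightarrow> grid_invariant H' E"
  unfolding grid_invariant_def by (meson subsetD)

text \<open>For finite \<open>P\<close> and positive \<open>c\<close> this is the set where
  \<open>max1 P i (indicator E)\<close> is at least \<open>c\<close>. Bounding its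
  \<open>N\<close>-measure by that of \<open>E\<close> is a weighted weak type inequality for
  indicators.\<close>

definition dense1 :: "('n::finite) corners set \<Rightarrow> ennreal \<Rightarrow> 'n \<Rightarrow> (real ^ 'n) set \<Rightarrow> (real ^ 'n) set" where
  "dense1 P c i E = {x. \<exists>p\<in>P. x $ i \<in> side p i \<and> c \<le> avg1 p i (indicator E) x}"

lemma dense1_measurable:
  assumes [measurable]: "E \<in> sets borel" and "finite P"
  shows "dense1 P c i E \<in> sets borel"
proof -
  have "dense1 P c i E = (\<Union>p\<in>P. {x \<in> space borel. x $ i \<in> side p i \<and> c \<le> avg1 p i (indicator E) x})"
    by (auto simp: dense1_def)
  also have "\<dots> \<in> sets borel"
    by (intro sets.finite_UN assms) measurable
  finally show ?thesis .
qed

lemma avg1_indicator_cong: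
  assumes "grid_invariant H E" "\<And>z. z \<in> H \<Longrightarrow> fst z \<noteq> i \<Longrightarrow> x $ fst z < snd z \<longleftrightarrow> y $ fst z < snd z"
  shows "upd x i t \<in> E \<longleftrightarrow> upd y i t \<in> E" "avg1 p i (indicator E) x = avg1 p i (indicator E) y"
proof -
  show *: "upd x i t \<in> E \<longleftrightarrow> upd y i t \<in> E" for t
  proof -
    have "\<forall>z\<in>H. upd x i t $ fst z < snd z \<longleftrightarrow> upd y i t $ fst z < snd z"
      using assms(2) by (auto simp: upd_nth)
    then show ?thesis using assms(1) unfolding grid_invariant_def by blast
  qed
  show "avg1 p i (indicator E) x = avg1 p i (indicator E) y"
    using * by (simp add: avg1_def indicator_def)
qed

text \<open>The only new hyperplanes are orthogonal to axis \<open>i\<close>, at the end points of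
  the sides of \<open>P\<close>. A finite grid thus stays finite and the operation can be
  iterated.\<close>

lemma grid_invariant_dense1:
  assumes "grid_invariant H E"
  shows "grid_invariant (H \<union> (\<lambda>p. (i, fst p $ i)) ` P \<union> (\<lambda>p. (i, snd p $ i)) ` P) (dense1 P c i E)"
  unfolding grid_invariant_def
proof (intro allI impI)
  fix x y :: "real^'a"
  assume xy: "\<forall>z\<in>H \<union> (\<lambda>p. (i, fst p $ i)) ` P \<union> (\<lambda>p. (i, snd p $ i)) ` P. (x $ fst z < snd z) = (y $ fst z < snd z)"
  have "avg1 p i (indicator E) x = avg1 p i (indicator E) y" for p
    by (rule avg1_indicator_cong[OF assms]) (use xy in auto)
  moreover have "x $ i \<in> side p i \<longleftrightarrow> y $ i \<in> side p i" if "p \<in> P" for p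
  proof -
    have "(x $ i < fst p $ i) = (y $ i < fst p $ i)" "(x $ i < snd p $ i) = (y $ i < snd p $ i)"
      using xy that by (auto simp: ball_Un)
    then show ?thesis by (auto simp: side_def not_less[symmetric])
  qed
  ultimately show "(x \<in> dense1 P c i E) = (y \<in> dense1 P c i E)"
    by (simp add: dense1_def)
qed

lemma emeasure_hbox_star:
  fixes p :: "('n::finite) corners"
  assumes "proper p"
  shows "emeasure lborel (hbox (star p i)) = 3 * emeasure lborel (hbox p)"
proof -
  have "(\<Prod>j\<in>UNIV. len (star p i) j) = 3 * (\<Prod>j\<in>UNIV. len p j)"
    by (subst (1 2) prod.remove[of UNIV i]) (auto simp: len_star intro!: prod.cong)
  then show ?thesis using assms
    by (simp add: emeasure_hbox proper_star ennreal_mult')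
qed

text \<open>In the cylinder \<open>K\<close> over a cell every line has the same section of
  \<open>E\<close>. A side on which this section has density \<open>c\<close> therefore yields a
  genuine box \<open>b p\<close> in which \<open>E\<close> has density \<open>c\<close>. Its dilate
  is three times as large, so \<open>D\<close> with density c/3 bounds the dilate by
  \<open>E\<close> inside \<open>b p\<close>, and a Vitali selection of sides makes these pieces
  disjoint.\<close>

lemma dense1_cell_bound:
  fixes N :: "(real ^ 'n) measure"
  assumes N: "sets N = sets borel"
    and D: "\<And>p E. proper p \<Longrightarrow> E \<in> sets borel \<Longrightarrow> E \<subseteq> hbox p \<Longrightarrow>
      ennreal (c / 3) * emeasure lborel (hbox p) \<le> emeasure lborel E \<Longrightarrow> emeasure N (hbox p) \<le> D * emeasure N E"
    and P: "finite P" "\<And>p. p \<in> P \<Longrightarrow> proper p"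
    and E [measurable]: "E \<in> sets borel" and c: "c \<ge> 0"
    and lu: "\<And>j. j \<noteq> i \<Longrightarrow> l $ j < u $ j"
    and K: "K = {y. \<forall>j. j \<noteq> i \<longrightarrow> l $ j \<le> y $ j \<and> y $ j < u $ j}" and x: "x \<in> K"
    and inv: "\<And>y t. y \<in> K \<Longrightarrow> upd y i t \<in> E \<longleftrightarrow> upd x i t \<in> E"
  shows "emeasure N (dense1 P (ennreal c) i E \<inter> K) \<le> D * emeasure N (E \<inter> K)"
proof -
  define J where "J = {p \<in> P. ennreal c \<le> avg1 p i (indicator E) x}"
  have J: "finite J" "\<And>p. p \<in> J \<Longrightarrow> proper p" using P by (auto simp: J_def)
  obtain Q where Q: "Q \<subseteq> J" "disjoint_family_on (\<lambda>p. side p i) Q"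
      "(\<Union>p\<in>J. side p i) \<subseteq> (\<Union>p\<in>Q. side (star p i) i)"
    using vitali_sides[OF J, of i] by blast
  have finQ: "finite Q" using Q(1) J(1) finite_subset by blast
  define b where "b p = (upd l i (fst p $ i), upd u i (snd p $ i))" for p :: "'n corners"
  have bb: "hbox (b p) = K \<inter> {y. y $ i \<in> side p i}" for p
    by (auto simp: hbox_def side_def b_def upd_nth K split: if_splits)
  have bs: "hbox (star (b p) i) = K \<inter> {y. y $ i \<in> side (star p i) i}" for p
    by (auto simp: hbox_def side_def star_def len_def b_def upd_nth K split: if_splits)
  have prb: "proper (b p)" if "p \<in> J" for p
    using J(2)[OF that] lu by (auto simp: proper_def b_def upd_nth)
  have upd_K: "upd y i t \<in> K \<longleftrightarrow> y \<in> K" for y t by (auto simp: K upd_nth)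
  have dens: "ennreal c * emeasure lborel (hbox (b p)) \<le> emeasure lborel (hbox (b p) \<inter> E)" if p: "p \<in> J" for p
  proof -
    have "(\<integral>\<^sup>+y. ennreal c * indicator (hbox (b p)) y \<partial>lborel) \<le> (\<integral>\<^sup>+y. indicator (hbox (b p) \<inter> E) y \<partial>lborel)"
    proof (rule nn_integral_slice_mono[where i=i])
      fix y
      show "(\<integral>\<^sup>+t. ennreal c * indicator (hbox (b p)) (upd y i t) \<partial>lborel)
        \<le> (\<integral>\<^sup>+t. indicator (hbox (b p) \<inter> E) (upd y i t) \<partial>lborel)"
      proof (cases "y \<in> K")
        case True
        have "(\<integral>\<^sup>+t. ennreal c * indicator (hbox (b p)) (upd y i t) \<partial>lborel)
           = (\<integral>\<^sup>+t. ennreal c * indicator (side p i) t \<partial>lborel)"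
          using True by (intro nn_integral_cong) (auto simp: bb upd_K upd_nth indicator_def)
        also have "\<dots> = ennreal c * ennreal (len p i)"
          using J(2)[OF p] by (simp add: nn_integral_cmult_indicator emeasure_side)
        also have "\<dots> \<le> avg1 p i (indicator E) x * ennreal (len p i)"
          using p by (intro mult_right_mono) (auto simp: J_def)
        also have "\<dots> = (\<integral>\<^sup>+t. indicator E (upd x i t) * indicator (side p i) t \<partial>lborel)"
          by (rule avg1_mult_len[OF J(2)[OF p]])
        also have "\<dots> = (\<integral>\<^sup>+t. indicator (hbox (b p) \<inter> E) (upd y i t) \<partial>lborel)"
          using True inv[OF True] by (intro nn_integral_cong) (auto simp: bb upd_K upd_nth indicator_def)
        finally show ?thesis .
      qed (auto simp: bb upd_K indicator_def)
    qed measurable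
    then show ?thesis by (simp add: nn_integral_cmult_indicator)
  qed
  have doub: "emeasure N (hbox (star (b p) i)) \<le> D * emeasure N (hbox (b p) \<inter> E)" if p: "p \<in> J" for p
  proof (rule D)
    show "hbox (b p) \<inter> E \<subseteq> hbox (star (b p) i)"
      using side_subset_star[OF J(2)[OF p], of i] by (auto simp: bb bs)
    have "ennreal (c / 3) * (3 * emeasure lborel (hbox (b p))) = ennreal c * emeasure lborel (hbox (b p))"
      using c ennreal_mult[of "c/3" 3] by (simp add: mult.assoc[symmetric])
    then show "ennreal (c / 3) * emeasure lborel (hbox (star (b p) i)) \<le> emeasure lborel (hbox (b p) \<inter> E)"
      using dens[OF p] by (simp add: emeasure_hbox_star prb p)
  qed (auto simp: proper_star prb p)
  have dK: "dense1 P (ennreal c) i E \<inter> K \<subseteq> (\<Union>p\<in>Q. hbox (star (b p) i))"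
  proof
    fix y assume y: "y \<in> dense1 P (ennreal c) i E \<inter> K"
    then obtain p where p: "p \<in> P" "y $ i \<in> side p i" "ennreal c \<le> avg1 p i (indicator E) y"
      by (auto simp: dense1_def)
    have "avg1 p i (indicator E) y = avg1 p i (indicator E) x"
      using inv[of y] y by (simp add: avg1_def indicator_def)
    then have "p \<in> J" using p by (simp add: J_def)
    then have "y $ i \<in> (\<Union>p\<in>Q. side (star p i) i)" using p(2) Q(3) by blast
    then show "y \<in> (\<Union>p\<in>Q. hbox (star (b p) i))" using y by (auto simp: bs)
  qed
  have QJ: "p \<in> J" if "p \<in> Q" for p using subsetD[OF Q(1) that] .
  have "emeasure N (dense1 P (ennreal c) i E \<inter> K) \<le> emeasure N (\<Union>p\<in>Q. hbox (star (b p) i))"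
    using finQ by (intro emeasure_mono dK) (auto simp: N intro!: sets.finite_UN)
  also have "\<dots> \<le> (\<Sum>p\<in>Q. emeasure N (hbox (star (b p) i)))"
    using finQ by (intro emeasure_subadditive_finite) (auto simp: N)
  also have "\<dots> \<le> (\<Sum>p\<in>Q. D * emeasure N (hbox (b p) \<inter> E))"
    by (intro sum_mono doub QJ)
  also have "\<dots> = D * emeasure N (\<Union>p\<in>Q. hbox (b p) \<inter> E)"
  proof -
    have "disjoint_family_on (\<lambda>p. hbox (b p) \<inter> E) Q"
      using Q(2) unfolding disjoint_family_on_def bb by blast
    then show ?thesis
      using finQ by (subst sum_emeasure[symmetric]) (auto simp: N sum_distrib_left)
  qed
  also have "\<dots> \<le> D * emeasure N (E \<inter> K)"
  proof (intro mult_left_mono emeasure_mono)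
    have "K = {y \<in> space borel. \<forall>j\<in>UNIV. j \<noteq> i \<longrightarrow> l $ j \<le> y $ j \<and> y $ j < u $ j}" by (simp add: K)
    also have "\<dots> \<in> sets borel" by measurable
    finally show "E \<inter> K \<in> sets N" by (auto simp: N)
  qed (auto simp: bb)
  finally show ?thesis .
qed

text \<open>The slab splits into finitely many cells, each coded by the set \<open>S\<close> of
  comparisons that hold in it. The hyperplanes at -m and m belong to the grid so that a cell has two
  finite faces in every direction other than \<open>i\<close>, as a box requires.\<close>

lemma dense1_slab_bound:
  fixes N :: "(real ^ 'n) measure"
  assumes N: "sets N = sets borel"
    and D: "\<And>p E. proper p \<Longrightarrow> E \<in> sets borel \<Longrightarrow> E \<subseteq> hbox p \<Longrightarrow>
      ennreal (c / 3) * emeasure lborel (hbox p) \<le> emeasure lborel E \<Longrightarrow> emeasure N (hbox p) \<le> D * emeasure N E"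
    and P: "finite P" "\<And>p. p \<in> P \<Longrightarrow> proper p"
    and E [measurable]: "E \<in> sets borel" and c: "c \<ge> 0"
    and H: "finite H" "grid_invariant H E" "\<And>j. (j, - m) \<in> H" "\<And>j. (j, m) \<in> H"
  shows "emeasure N (dense1 P (ennreal c) i E \<inter> {x. \<forall>j. j \<noteq> i \<longrightarrow> - m \<le> x $ j \<and> x $ j < m})
    \<le> D * emeasure N E"
proof -
  define C where "C = {x::real^'n. \<forall>j. j \<noteq> i \<longrightarrow> - m \<le> x $ j \<and> x $ j < m}"
  define H' where "H' = {z\<in>H. fst z \<noteq> i}"
  define K where "K S = {x\<in>C. \<forall>z\<in>H'. x $ fst z < snd z \<longleftrightarrow> z \<in> S}" for S
  have finH': "finite H'" using H(1) by (simp add: H'_def)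
  note [measurable] = dense1_measurable[OF E P(1)]
  have Km [measurable]: "K S \<in> sets borel" for S
  proof -
    have "K S = {x \<in> space borel. (\<forall>j\<in>UNIV. j \<noteq> i \<longrightarrow> - m \<le> x $ j \<and> x $ j < m) \<and> (\<forall>z\<in>H'. x $ fst z < snd z \<longleftrightarrow> z \<in> S)}"
      by (auto simp: K_def C_def)
    also have "\<dots> \<in> sets borel" using finH' by measurable
    finally show ?thesis .
  qed
  have cell: "emeasure N (dense1 P (ennreal c) i E \<inter> K S) \<le> D * emeasure N (E \<inter> K S)" for S
  proof (cases "K S = {}")
    case False
    then obtain x where x: "x \<in> K S" by auto
    \<comment> \<open>The faces of the cell of \<open>x\<close> are the nearest grid values below
      and above its coordinates: the maximum of \<open>lo j\<close> and the minimum of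
      \<open>up j\<close>.\<close>
    define lo where "lo j = {a. (j, a) \<in> H \<and> a \<le> x $ j}" for j
    define up where "up j = {a. (j, a) \<in> H \<and> x $ j < a}" for j
    have "finite (snd ` H)" using H(1) by simp
    moreover have "lo j \<subseteq> snd ` H" "up j \<subseteq> snd ` H" for j by (force simp: lo_def up_def)+
    ultimately have fin: "finite (lo j)" "finite (up j)" for j by (meson finite_subset)+
    have mem: "- m \<in> lo j" "m \<in> up j" if "j \<noteq> i" for j
      using x that H(3,4) by (auto simp: lo_def up_def K_def C_def)
    define l where "l = (\<chi> j. Max (lo j))"
    define u where "u = (\<chi> j. Min (up j))"
    have l_iff: "l $ j \<le> r \<longleftrightarrow> (\<forall>a\<in>lo j. a \<le> r)" if "j \<noteq> i" for j r
      using Max_le_iff[OF fin(1), of j r] mem[OF that] by (auto simp: l_def)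
    have u_iff: "r < u $ j \<longleftrightarrow> (\<forall>a\<in>up j. r < a)" if "j \<noteq> i" for j r
      using Min_gr_iff[OF fin(2), of j r] mem[OF that] by (auto simp: u_def)
    have xs: "l $ j \<le> x $ j" "x $ j < u $ j" if "j \<noteq> i" for j
      using that by (auto simp: l_iff u_iff) (auto simp: lo_def up_def)
    have Keq: "K S = {y. \<forall>j. j \<noteq> i \<longrightarrow> l $ j \<le> y $ j \<and> y $ j < u $ j}"
    proof (intro set_eqI iffI)
      fix y assume y: "y \<in> K S"
      have *: "y $ j < a \<longleftrightarrow> x $ j < a" if "j \<noteq> i" "(j, a) \<in> H" for j a
        using x y that by (force simp: K_def H'_def)
      have "a \<le> y $ j \<longleftrightarrow> a \<le> x $ j" if "j \<noteq> i" "(j, a) \<in> H" for j a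
        using *[OF that] by linarith
      with * show "y \<in> {y. \<forall>j. j \<noteq> i \<longrightarrow> l $ j \<le> y $ j \<and> y $ j < u $ j}"
        by (auto simp: l_iff u_iff lo_def up_def)
    next
      fix y assume "y \<in> {y. \<forall>j. j \<noteq> i \<longrightarrow> l $ j \<le> y $ j \<and> y $ j < u $ j}"
      then have y: "\<And>j a. j \<noteq> i \<Longrightarrow> a \<in> lo j \<Longrightarrow> a \<le> y $ j" "\<And>j a. j \<noteq> i \<Longrightarrow> a \<in> up j \<Longrightarrow> y $ j < a"
        by (auto simp: l_iff u_iff)
      have "y \<in> C" unfolding C_def using y mem by blast
      moreover have "y $ j < a \<longleftrightarrow> x $ j < a" if "j \<noteq> i" "(j, a) \<in> H" for j a
        using y[of j a] that by (force simp: lo_def up_def)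
      ultimately show "y \<in> K S" using x by (auto simp: K_def H'_def)
    qed
    show ?thesis
    proof (rule dense1_cell_bound[OF N D P E c _ Keq x])
      show "l $ j < u $ j" if "j \<noteq> i" for j using xs[OF that] by simp
      show "upd y i t \<in> E \<longleftrightarrow> upd x i t \<in> E" if "y \<in> K S" for y t
        by (rule avg1_indicator_cong(1)[OF H(2)]) (use that x in \<open>auto simp: K_def H'_def\<close>)
    qed
  qed simp
  have CK: "C \<subseteq> (\<Union>S\<in>Pow H'. K S)"
  proof
    fix x assume "x \<in> C"
    then have "x \<in> K {z\<in>H'. x $ fst z < snd z}" by (auto simp: K_def)
    then show "x \<in> (\<Union>S\<in>Pow H'. K S)"
      by (intro UN_I[of "{z\<in>H'. x $ fst z < snd z}"]) auto
  qed
  have "emeasure N (dense1 P (ennreal c) i E \<inter> C) \<le> emeasure N (\<Union>S\<in>Pow H'. dense1 P (ennreal c) i E \<inter> K S)"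
  proof (rule emeasure_mono)
    show "dense1 P (ennreal c) i E \<inter> C \<subseteq> (\<Union>S\<in>Pow H'. dense1 P (ennreal c) i E \<inter> K S)"
      unfolding Int_UN_distrib[symmetric] using CK by (rule Int_mono[OF subset_refl])
    show "(\<Union>S\<in>Pow H'. dense1 P (ennreal c) i E \<inter> K S) \<in> sets N"
      unfolding N using finH' by (intro sets.finite_UN) simp_all
  qed
  also have "\<dots> \<le> (\<Sum>S\<in>Pow H'. emeasure N (dense1 P (ennreal c) i E \<inter> K S))"
    using finH' by (intro emeasure_subadditive_finite) (auto simp: N)
  also have "\<dots> \<le> (\<Sum>S\<in>Pow H'. D * emeasure N (E \<inter> K S))"
    by (intro sum_mono cell)
  also have "\<dots> = D * emeasure N (\<Union>S\<in>Pow H'. E \<inter> K S)"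
  proof -
    have "disjoint_family_on (\<lambda>S. E \<inter> K S) (Pow H')"
      by (auto simp: disjoint_family_on_def K_def)
    then show ?thesis
      using finH' by (subst sum_emeasure[symmetric]) (auto simp: N sum_distrib_left)
  qed
  also have "\<dots> \<le> D * emeasure N E"
    by (intro mult_left_mono emeasure_mono) (auto simp: N)
  finally show ?thesis unfolding C_def .
qed

text \<open>The slab bound has a constant independent of \<open>m\<close> and of the grid, so the
  slabs can grow to the whole space by continuity from below.\<close>

lemma dense1_bound:
  fixes N :: "(real ^ 'n) measure"
  assumes "ainf N" "c > 0"
  shows "\<exists>D\<ge>0. \<forall>P H E i. finite P \<longrightarrow> (\<forall>p\<in>P. proper p) \<longrightarrow> E \<in> sets borel \<longrightarrow> finite H \<longrightarrow> grid_invariant H E \<longrightarrow>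
    emeasure N (dense1 P (ennreal c) i E) \<le> ennreal D * emeasure N E"
proof -
  have N: "sets N = sets borel" using assms(1) by (simp add: ainf_def)
  have "c / 3 > 0" using assms(2) by simp
  then obtain D where "D \<ge> 0" and D: "\<And>p E. proper p \<Longrightarrow> E \<in> sets borel \<Longrightarrow> E \<subseteq> hbox p \<Longrightarrow>
      ennreal (c / 3) * emeasure lborel (hbox p) \<le> emeasure lborel E \<Longrightarrow> emeasure N (hbox p) \<le> ennreal D * emeasure N E"
    using assms(1) unfolding ainf_def by blast
  have "emeasure N (dense1 P (ennreal c) i E) \<le> ennreal D * emeasure N E"
    if P: "finite P" "\<forall>p\<in>P. proper p" and E: "E \<in> sets borel" and H: "finite H" "grid_invariant H E" for P H E i
  proof -
    define F where "F m = dense1 P (ennreal c) i E \<inter> {x. \<forall>j. j \<noteq> i \<longrightarrow> - real m \<le> x $ j \<and> x $ j < real m}" for m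
    have F: "emeasure N (F m) \<le> ennreal D * emeasure N E" for m
      unfolding F_def
    proof (rule dense1_slab_bound[OF N D])
      show "finite (H \<union> (\<lambda>j. (j, - real m)) ` UNIV \<union> (\<lambda>j. (j, real m)) ` UNIV)" using H(1) by simp
      show "grid_invariant (H \<union> (\<lambda>j. (j, - real m)) ` UNIV \<union> (\<lambda>j. (j, real m)) ` UNIV) E"
        by (rule grid_invariant_mono[OF H(2)]) auto
    qed (use P E assms(2) in auto)
    have Fm: "F m \<in> sets N" for m
    proof -
      have "{x. \<forall>j. j \<noteq> i \<longrightarrow> - real m \<le> x $ j \<and> x $ j < real m}
        = {x \<in> space borel. \<forall>j\<in>UNIV. j \<noteq> i \<longrightarrow> - real m \<le> x $ j \<and> x $ j < real m}" by simp
      also have "\<dots> \<in> sets borel" by measurable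
      finally show ?thesis using dense1_measurable[OF E P(1)] by (auto simp: F_def N)
    qed
    have "x \<in> (\<Union>m. {x. \<forall>j. j \<noteq> i \<longrightarrow> - real m \<le> x $ j \<and> x $ j < real m})" for x :: "real^'n"
    proof -
      obtain m where m: "norm x < real m" using reals_Archimedean2 by blast
      have "- real m \<le> x $ j \<and> x $ j < real m" for j
        using component_le_norm_cart[of x j] m by auto
      then show ?thesis by auto
    qed
    then have UF: "(\<Union>m. F m) = dense1 P (ennreal c) i E" by (auto simp: F_def)
    have "incseq F"
      by (rule incseq_SucI) (force simp: F_def)
    then have "(SUP m. emeasure N (F m)) = emeasure N (\<Union>m. F m)"
      using Fm by (intro SUP_emeasure_incseq) auto
    then show ?thesis unfolding UF[symmetric] using F by (metis SUP_least)
  qed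
  then show ?thesis using \<open>D \<ge> 0\<close> by blast
qed

section \<open>Iterated density sets and covering of half-covered boxes\<close>

abbreviation "denses P c js E \<equiv> foldr (dense1 P c) js E"

text \<open>The grid grows at every step, so uniformity of the one-step constant in \<open>H\<close>
  is essential. The constants multiply.\<close>

lemma denses_bound:
  fixes N :: "(real ^ 'n) measure" and js :: "'n list"
  assumes "ainf N" "c > 0"
  shows "\<exists>D\<ge>0. \<forall>P H E. finite P \<longrightarrow> (\<forall>p\<in>P. proper p) \<longrightarrow> E \<in> sets borel \<longrightarrow> finite H \<longrightarrow> grid_invariant H E \<longrightarrow>
    emeasure N (denses P (ennreal c) js E) \<le> ennreal D * emeasure N E"
proof -
  obtain D where "D \<ge> 0" and D: "\<And>P H E i. finite P \<Longrightarrow> (\<forall>p\<in>P. proper p) \<Longrightarrow> E \<in> sets borel \<Longrightarrow> finite H \<Longrightarrow> grid_invariant H E \<Longrightarrow>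
    emeasure N (dense1 P (ennreal c) i E) \<le> ennreal D * emeasure N E"
    using dense1_bound[OF assms] by blast
  have "denses P (ennreal c) js E \<in> sets borel \<and> (\<exists>H. finite H \<and> grid_invariant H (denses P (ennreal c) js E)) \<and>
    emeasure N (denses P (ennreal c) js E) \<le> ennreal D ^ length js * emeasure N E"
    if P: "finite P" "\<forall>p\<in>P. proper p" and E: "E \<in> sets borel" and H: "finite H" "grid_invariant H E" for P H E
  proof (induction js)
    case Nil
    then show ?case using E H by auto
  next
    case (Cons i js)
    define F where "F = denses P (ennreal c) js E"
    from Cons obtain H' where F: "F \<in> sets borel" "finite H'" "grid_invariant H' F"
      "emeasure N F \<le> ennreal D ^ length js * emeasure N E" by (auto simp: F_def)
    have "emeasure N (dense1 P (ennreal c) i F) \<le> ennreal D * emeasure N F"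
      by (rule D[OF P F(1-3)])
    also have "\<dots> \<le> ennreal D * (ennreal D ^ length js * emeasure N E)"
      by (intro mult_left_mono F(4)) simp
    finally have "emeasure N (dense1 P (ennreal c) i F) \<le> ennreal D ^ length (i # js) * emeasure N E"
      by (simp add: mult.assoc)
    moreover have "\<exists>H. finite H \<and> grid_invariant H (dense1 P (ennreal c) i F)"
      using grid_invariant_dense1[OF F(3), of i P "ennreal c"] F(2) P(1)
      by (intro exI[of _ "H' \<union> (\<lambda>p. (i, fst p $ i)) ` P \<union> (\<lambda>p. (i, snd p $ i)) ` P"]) simp
    ultimately show ?case using dense1_measurable[OF F(1) P(1)] by (simp add: F_def)
  qed
  then show ?thesis using \<open>D \<ge> 0\<close> by (intro exI[of _ "D ^ length js"]) (auto simp: ennreal_power)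
qed

text \<open>Each averaging step loses at most \<open>c\<close>: an average of an indicator below
  \<open>c\<close> goes into the error, and one that is at least \<open>c\<close> puts the point
  into the next density set. Hence a point of the box with iterated average above
  \<open>length js * c\<close> lies in the last density set.\<close>

lemma avgs_indicator_le:
  assumes "finite P" "\<And>p. p \<in> P \<Longrightarrow> proper p" "E \<in> sets borel" "p \<in> P" "x \<in> hbox p"
  shows "avgs p js (indicator E) x \<le> indicator (denses P c js E) x + of_nat (length js) * c"
  using assms(5)
proof (induction js arbitrary: x)
  case (Cons j js)
  define F where "F = denses P c js E"
  define k where "k = of_nat (length js) * c"
  have Fm [measurable]: "F \<in> sets borel"
    unfolding F_def using assms by (induction js) (auto intro: dense1_measurable)
  have xj: "x $ j \<in> side p j" using Cons.prems by (simp add: hbox_def)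
  have "avg1 p j (avgs p js (indicator E)) x \<le> avg1 p j (\<lambda>x. indicator F x + k) x"
    unfolding F_def k_def
    by (rule avg1_mono, rule Cons.IH) (use Cons.prems in \<open>auto simp: hbox_def upd_nth\<close>)
  also have "\<dots> = avg1 p j (indicator F) x + k"
    using assms(2)[OF assms(4)] by (subst avg1_add) auto
  also have "avg1 p j (indicator F) x \<le> indicator (dense1 P c j F) x + c"
  proof (cases "c \<le> avg1 p j (indicator F) x")
    case True
    have "avg1 p j (indicator F) x \<le> avg1 p j (\<lambda>_. 1) x"
      by (rule avg1_mono) (auto simp: indicator_def)
    also have "\<dots> = 1" using assms(2)[OF assms(4)] by simp
    also have "1 \<le> indicator (dense1 P c j F) x + c"
      using True xj assms(4) by (auto simp: dense1_def indicator_def)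
    finally show ?thesis .
  qed (auto simp: not_le intro: order_trans[OF less_imp_le] add_increasing)
  finally show ?case by (simp add: F_def k_def distrib_right add.assoc add_right_mono)
qed simp

text \<open>For a box of \<open>P\<close> the iterated average of the indicator of the union over
  \<open>Q\<close> is its density, at least 1/2. Off the iterated density set it would be at most n
  * c = 1/4, so the whole box lies in that set.\<close>

lemma density_cover_bound:
  fixes N :: "(real ^ 'n) measure"
  assumes "ainf N"
  shows "\<exists>D\<ge>0. \<forall>P Q. finite P \<longrightarrow> (\<forall>p\<in>P. proper p) \<longrightarrow> finite Q \<longrightarrow>
    (\<forall>p\<in>P. emeasure lborel (hbox p) \<le> 2 * emeasure lborel (hbox p \<inter> (\<Union>q\<in>Q. hbox q))) \<longrightarrow>
    emeasure N (\<Union>p\<in>P. hbox p) \<le> ennreal D * emeasure N (\<Union>q\<in>Q. hbox q)"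
proof -
  obtain js where js: "set js = (UNIV :: 'n set)" "distinct js" using finite_distinct_list[of "UNIV :: 'n set"] by auto
  define n where "n = length js"
  have n: "n > 0" using js(1) by (auto simp: n_def)
  define c where "c = 1 / (4 * real n)"
  have c: "c > 0" using n by (simp add: c_def)
  obtain D where "D \<ge> 0" and D: "\<And>P H E. finite P \<Longrightarrow> (\<forall>p\<in>P. proper p) \<Longrightarrow> E \<in> sets borel \<Longrightarrow> finite H \<Longrightarrow> grid_invariant H E \<Longrightarrow>
    emeasure N (denses P (ennreal c) js E) \<le> ennreal D * emeasure N E"
    using denses_bound[OF assms c, of js] by blast
  have "emeasure N (\<Union>p\<in>P. hbox p) \<le> ennreal D * emeasure N (\<Union>q\<in>Q. hbox q)"
    if P: "finite P" "\<forall>p\<in>P. proper p" and Q: "finite Q"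
      and half: "\<forall>p\<in>P. emeasure lborel (hbox p) \<le> 2 * emeasure lborel (hbox p \<inter> (\<Union>q\<in>Q. hbox q))" for P Q
  proof -
    define E where "E = (\<Union>q\<in>Q. hbox q)"
    have E [measurable]: "E \<in> sets borel" unfolding E_def using Q by (intro sets.finite_UN) auto
    define H where "H = (\<lambda>(j, q). (j, fst q $ j)) ` (UNIV \<times> Q) \<union> (\<lambda>(j, q). (j, snd q $ j)) ` (UNIV \<times> Q)"
    have H: "finite H" using Q by (simp add: H_def)
    have "grid_invariant H E"
      unfolding grid_invariant_def
    proof (intro allI impI)
      fix x y assume xy: "\<forall>z\<in>H. (x $ fst z < snd z) = (y $ fst z < snd z)"
      have "x $ j \<in> side q j \<longleftrightarrow> y $ j \<in> side q j" if "q \<in> Q" for q j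
      proof -
        have "(j, fst q $ j) \<in> H" "(j, snd q $ j) \<in> H"
          using that by (force simp: H_def)+
        with xy have "(x $ j < fst q $ j) = (y $ j < fst q $ j)" "(x $ j < snd q $ j) = (y $ j < snd q $ j)" by force+
        then show ?thesis by (auto simp: side_def not_less[symmetric])
      qed
      then show "(x \<in> E) = (y \<in> E)" by (simp add: E_def hbox_def)
    qed
    note bound = D[OF P E H this]
    have "hbox p \<subseteq> denses P (ennreal c) js E" if p: "p \<in> P" for p
    proof
      fix x assume x: "x \<in> hbox p"
      have pp: "proper p" using P(2) p by blast
      define v where "v = emeasure lborel (hbox p)"
      define A where "A = avgs p js (indicator E) x"
      have v: "v \<noteq> 0" "v \<noteq> \<infinity>" using emeasure_hbox_pos[OF pp] emeasure_hbox_finite[OF pp] by (auto simp: v_def)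
      have "A * v = emeasure lborel (E \<inter> hbox p)"
        unfolding A_def v_def using js pp
        by (subst avgs_full) (auto simp: indicator_inter_arith[symmetric])
      then have "v \<le> 2 * (A * v)"
        using half p by (simp add: v_def E_def Int_commute)
      then have A1: "1 \<le> 2 * A"
        using v by (cases v; cases A) (auto simp: ennreal_mult[symmetric] ennreal_numeral[symmetric] ennreal_1[symmetric] simp del: ennreal_numeral ennreal_1)
      have "A \<le> indicator (denses P (ennreal c) js E) x + of_nat n * ennreal c"
        unfolding A_def n_def using P p x by (intro avgs_indicator_le) auto
      also have "of_nat n * ennreal c = ennreal (1/4)"
        using n c by (simp add: ennreal_of_nat_eq_real_of_nat ennreal_mult[symmetric] c_def)
      finally have A2: "A \<le> indicator (denses P (ennreal c) js E) x + ennreal (1/4)" .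
      show "x \<in> denses P (ennreal c) js E"
      proof (rule ccontr)
        assume "x \<notin> denses P (ennreal c) js E"
        then have "2 * A \<le> 2 * ennreal (1/4)" using A2 by (intro mult_left_mono) auto
        also have "\<dots> = ennreal (1/2)" using ennreal_mult[of 2 "1/4"] by simp
        also have "\<dots> < 1" by (subst ennreal_1[symmetric], subst ennreal_less_iff) auto
        finally show False using A1 by simp
      qed
    qed
    then have "(\<Union>p\<in>P. hbox p) \<subseteq> denses P (ennreal c) js E" by blast
    moreover have "denses P (ennreal c) js E \<in> sets N"
    proof -
      have "denses P (ennreal c) js E \<in> sets borel"
        by (induction js) (auto intro: dense1_measurable P)
      then show ?thesis using assms by (simp add: ainf_def)
    qed
    ultimately show ?thesis using bound unfolding E_def by (meson emeasure_mono order_trans)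
  qed
  then show ?thesis using \<open>D \<ge> 0\<close> by blast
qed

section \<open>Selection of a sparse subfamily\<close>

text \<open>The list is in reverse order of selection: the head was chosen last and is shortest in
  direction \<open>i\<close>, the tail holds the boxes chosen before it.\<close>

fun sparse :: "'n::finite \<Rightarrow> 'n corners list \<Rightarrow> bool" where
  "sparse i [] \<longleftrightarrow> True"
| "sparse i (k # S) \<longleftrightarrow> sparse i S \<and> k \<notin> set S \<and> (\<forall>j\<in>set S. len k i \<le> len j i) \<and>
    2 * emeasure lborel (hbox k \<inter> (\<Union>j\<in>set S. hbox (star j i))) \<le> emeasure lborel (hbox k)"

lemma UN_hbox_measurable [measurable]: "finite Q \<Longrightarrow> (\<Union>q\<in>Q. hbox (f q)) \<in> sets borel"
  by (intro sets.finite_UN) auto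

text \<open>Omitting earlier boxes only shrinks the overlap. This admits the subfamilies on which
  w(R)/|R| exceeds a level.\<close>

lemma sparse_filter: "sparse i S \<Longrightarrow> sparse i (filter R S)"
proof (induction S)
  case (Cons k S)
  have "emeasure lborel (hbox k \<inter> (\<Union>j\<in>set (filter R S). hbox (star j i)))
    \<le> emeasure lborel (hbox k \<inter> (\<Union>j\<in>set S. hbox (star j i)))"
    by (intro emeasure_mono Int_mono UN_mono) (auto intro!: sets.Int UN_hbox_measurable)
  then have "2 * emeasure lborel (hbox k \<inter> (\<Union>j\<in>set (filter R S). hbox (star j i)))
    \<le> 2 * emeasure lborel (hbox k \<inter> (\<Union>j\<in>set S. hbox (star j i)))"
    by (intro mult_left_mono) auto
  with Cons show ?case by (auto simp del: UN_simps intro: order_trans)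
qed simp

text \<open>The input is sorted by increasing length, so recursion on the tail handles longer boxes
  first, which is the greedy order. A rejected box remains half covered when further boxes are
  selected.\<close>

lemma sparse_selection:
  fixes xs :: "('n::finite) corners list"
  assumes "distinct xs" "sorted_wrt (\<lambda>p q. len p i \<le> len q i) xs"
  shows "\<exists>S. set S \<subseteq> set xs \<and> sparse i S \<and> (\<forall>p\<in>set xs - set S.
    emeasure lborel (hbox p) \<le> 2 * emeasure lborel (hbox p \<inter> (\<Union>j\<in>set S. hbox (star j i))))"
  using assms
proof (induction xs)
  case Nil
  then show ?case by (intro exI[of _ "[]"]) simp
next
  case (Cons k xs)
  then obtain S where S: "set S \<subseteq> set xs" "sparse i S" and rest: "\<And>p. p \<in> set xs - set S \<Longrightarrow>
    emeasure lborel (hbox p) \<le> 2 * emeasure lborel (hbox p \<inter> (\<Union>j\<in>set S. hbox (star j i)))"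
    by auto
  show ?case
  proof (cases "2 * emeasure lborel (hbox k \<inter> (\<Union>j\<in>set S. hbox (star j i))) \<le> emeasure lborel (hbox k)")
    case True
    have "emeasure lborel (hbox p) \<le> 2 * emeasure lborel (hbox p \<inter> (\<Union>j\<in>set (k # S). hbox (star j i)))"
      if "p \<in> set (k # xs) - set (k # S)" for p
    proof -
      have "emeasure lborel (hbox p \<inter> (\<Union>j\<in>set S. hbox (star j i)))
        \<le> emeasure lborel (hbox p \<inter> (\<Union>j\<in>set (k # S). hbox (star j i)))"
        by (intro emeasure_mono Int_mono UN_mono) (auto intro!: sets.Int UN_hbox_measurable simp del: UN_insert)
      then have "2 * emeasure lborel (hbox p \<inter> (\<Union>j\<in>set S. hbox (star j i)))
        \<le> 2 * emeasure lborel (hbox p \<inter> (\<Union>j\<in>set (k # S). hbox (star j i)))"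
        by (intro mult_left_mono) auto
      then show ?thesis using rest[of p] that by (auto intro: order_trans)
    qed
    moreover have "sparse i (k # S)" using True S Cons.prems by auto
    ultimately show ?thesis using S(1) by (intro exI[of _ "k # S"]) auto
  next
    case False
    have "emeasure lborel (hbox p) \<le> 2 * emeasure lborel (hbox p \<inter> (\<Union>j\<in>set S. hbox (star j i)))"
      if "p \<in> set (k # xs) - set S" for p
      using that rest[of p] False by (cases "p = k") auto
    then show ?thesis using S by (intro exI[of _ S]) auto
  qed
qed

lemma half_complement:
  fixes v :: ennreal
  assumes "v = a + b" "2 * b \<le> v" "v \<noteq> \<infinity>"
  shows "v \<le> 2 * a"
proof -
  have "v + v = 2 * a + 2 * b" using assms(1) by (simp add: mult_2 add_ac)
  also have "\<dots> \<le> 2 * a + v" using assms(2) by (rule add_left_mono)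
  finally have "v + v \<le> v + 2 * a" by (simp add: add.commute)
  then show ?thesis using assms(3) by simp
qed

text \<open>\<open>F\<close> discards a point if its coordinates other than \<open>i\<close> fit an
  earlier box whose side \<open>i\<close> meets that of \<open>k\<close>. Such a point of
  \<open>k\<close> lies in the dilate of that longer box, so at most half of \<open>k\<close> is
  lost. As \<open>F\<close> is independent of coordinate \<open>i\<close>, averaging its indicator
  over \<open>js\<close> gives a constant, at least 1/2; adjointness then moves the averages onto
  \<open>h\<close>.\<close>

lemma sparse_step:
  fixes k :: "('n::finite) corners"
  assumes "sparse i (k # S)" "proper k" and [measurable]: "h \<in> borel_measurable borel"
    and js: "set js = UNIV - {i}"
  shows "\<exists>F\<in>sets borel. F \<subseteq> hbox k \<and> F \<inter> (\<Union>j\<in>set S. hbox j) = {} \<and>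
    (\<integral>\<^sup>+x. h x * indicator (hbox k) x \<partial>lborel) \<le> 2 * (\<integral>\<^sup>+x. avgs k js h x * indicator F x \<partial>lborel)"
proof -
  define F where "F = {x. \<forall>j\<in>set S. side j i \<inter> side k i \<noteq> {} \<longrightarrow> (\<exists>l\<in>UNIV. l \<noteq> i \<and> x $ l \<notin> side j l)}"
  have "F = {x \<in> space borel. \<forall>j\<in>set S. side j i \<inter> side k i \<noteq> {} \<longrightarrow> (\<exists>l\<in>UNIV. l \<noteq> i \<and> x $ l \<notin> side j l)}"
    by (simp add: F_def)
  also have "\<dots> \<in> sets borel" by measurable
  finally have F [measurable]: "F \<in> sets borel" .
  have indF: "indep i (indicator F :: _ \<Rightarrow> ennreal)"
    by (auto simp: indep_def F_def upd_nth indicator_def)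
  define v where "v = emeasure lborel (hbox k)"
  have v: "v \<noteq> 0" "v \<noteq> \<infinity>" using emeasure_hbox_pos[OF assms(2)] emeasure_hbox_finite[OF assms(2)] by (auto simp: v_def)
  have "hbox k - F \<subseteq> hbox k \<inter> (\<Union>j\<in>set S. hbox (star j i))"
  proof
    fix x assume x: "x \<in> hbox k - F"
    then obtain j where j: "j \<in> set S" "side j i \<inter> side k i \<noteq> {}" "\<And>l. l \<noteq> i \<Longrightarrow> x $ l \<in> side j l"
      by (auto simp: F_def)
    have "side k i \<subseteq> side (star j i) i"
      using j assms(1) by (intro side_star_covers) (auto simp: Int_commute)
    then have "x \<in> hbox (star j i)"
      using x j(3) by (auto simp: hbox_def) (metis subsetD side_star)
    then show "x \<in> hbox k \<inter> (\<Union>j\<in>set S. hbox (star j i))" using x j(1) by auto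
  qed
  then have "emeasure lborel (hbox k - F) \<le> emeasure lborel (hbox k \<inter> (\<Union>j\<in>set S. hbox (star j i)))"
    by (intro emeasure_mono) (auto intro!: sets.Int UN_hbox_measurable)
  then have "2 * emeasure lborel (hbox k - F) \<le> 2 * emeasure lborel (hbox k \<inter> (\<Union>j\<in>set S. hbox (star j i)))"
    by (intro mult_left_mono) auto
  also have "\<dots> \<le> v" using assms(1) by (simp add: v_def)
  finally have small: "2 * emeasure lborel (hbox k - F) \<le> v" .
  have "v = emeasure lborel (hbox k \<inter> F) + emeasure lborel (hbox k - F)"
    unfolding v_def by (subst plus_emeasure) (auto intro!: arg_cong[where f="emeasure lborel"])
  then have half: "v \<le> 2 * emeasure lborel (hbox k \<inter> F)"
    by (rule half_complement[OF _ small v(2)])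
  have avgF: "1 \<le> 2 * avgs k (rev js) (indicator F) x" for x
  proof -
    define A where "A = avgs k (rev js) (indicator F) x"
    have "A * v = emeasure lborel (F \<inter> hbox k)"
      unfolding A_def v_def using js indF assms(2)
      by (subst avgs_full) (auto simp: indicator_inter_arith[symmetric])
    with half have "v \<le> 2 * (A * v)" by (simp add: Int_commute)
    then have "1 \<le> 2 * A"
      using v by (cases v; cases A) (auto simp: ennreal_mult[symmetric] ennreal_numeral[symmetric] ennreal_1[symmetric] simp del: ennreal_numeral ennreal_1)
    then show ?thesis by (simp add: A_def)
  qed
  have "(\<integral>\<^sup>+x. h x * indicator (hbox k) x \<partial>lborel)
    \<le> (\<integral>\<^sup>+x. 2 * (avgs k (rev js) (indicator F) x * h x * indicator (hbox k) x) \<partial>lborel)"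
  proof (intro nn_integral_mono)
    fix x
    have "1 * (h x * indicator (hbox k) x) \<le> (2 * avgs k (rev js) (indicator F) x) * (h x * indicator (hbox k) x)"
      by (intro mult_right_mono avgF) auto
    then show "h x * indicator (hbox k) x \<le> 2 * (avgs k (rev js) (indicator F) x * h x * indicator (hbox k) x)"
      by (simp add: mult.assoc)
  qed
  also have "\<dots> = 2 * (\<integral>\<^sup>+x. avgs k (rev js) (indicator F) x * h x * indicator (hbox k) x \<partial>lborel)"
    by (intro nn_integral_cmult) measurable
  also have "\<dots> = 2 * (\<integral>\<^sup>+x. indicator F x * avgs k js h x * indicator (hbox k) x \<partial>lborel)"
    using assms(2) by (subst avgs_adjoint) auto
  also have "\<dots> = 2 * (\<integral>\<^sup>+x. avgs k js h x * indicator (F \<inter> hbox k) x \<partial>lborel)"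
    by (simp add: indicator_inter_arith mult_ac)
  finally have "(\<integral>\<^sup>+x. h x * indicator (hbox k) x \<partial>lborel) \<le> 2 * (\<integral>\<^sup>+x. avgs k js h x * indicator (F \<inter> hbox k) x \<partial>lborel)" .
  moreover have "(F \<inter> hbox k) \<inter> (\<Union>j\<in>set S. hbox j) = {}"
    by (auto simp: F_def hbox_def)
  ultimately show ?thesis by (intro bexI[of _ "F \<inter> hbox k"]) auto
qed

text \<open>The set found for the head avoids all boxes of the tail, so the sets for different boxes
  are disjoint and their integrals add up inside the union.\<close>

lemma sparse_sum_le_maximal:
  fixes S :: "('n::finite) corners list"
  assumes "sparse i S" "\<forall>p\<in>set S. proper p" and [measurable]: "h \<in> borel_measurable borel" "H \<in> borel_measurable borel"
    and js: "set js = UNIV - {i}"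
    and le: "\<And>p x. p \<in> set S \<Longrightarrow> x \<in> hbox p \<Longrightarrow> avgs p js h x \<le> H x"
  shows "(\<Sum>p\<in>set S. \<integral>\<^sup>+x. h x * indicator (hbox p) x \<partial>lborel)
    \<le> 2 * (\<integral>\<^sup>+x. H x * indicator (\<Union>p\<in>set S. hbox p) x \<partial>lborel)"
  using assms(1,2) le
proof (induction S)
  case (Cons k S)
  obtain F where F [measurable]: "F \<in> sets borel" and F': "F \<subseteq> hbox k" "F \<inter> (\<Union>j\<in>set S. hbox j) = {}"
    "(\<integral>\<^sup>+x. h x * indicator (hbox k) x \<partial>lborel) \<le> 2 * (\<integral>\<^sup>+x. avgs k js h x * indicator F x \<partial>lborel)"
    using sparse_step[OF Cons.prems(1) _ assms(3) js] Cons.prems(2) by auto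
  define \<Omega> where "\<Omega> = (\<Union>p\<in>set S. hbox p)"
  have [measurable]: "\<Omega> \<in> sets borel" unfolding \<Omega>_def by (rule UN_hbox_measurable) simp
  have IH: "(\<Sum>p\<in>set S. \<integral>\<^sup>+x. h x * indicator (hbox p) x \<partial>lborel) \<le> 2 * (\<integral>\<^sup>+x. H x * indicator \<Omega> x \<partial>lborel)"
    unfolding \<Omega>_def by (rule Cons.IH) (use Cons.prems in auto)
  have "(\<integral>\<^sup>+x. h x * indicator (hbox k) x \<partial>lborel) \<le> 2 * (\<integral>\<^sup>+x. H x * indicator F x \<partial>lborel)"
    by (rule order_trans[OF F'(3)], intro mult_left_mono nn_integral_mono)
       (use F'(1) Cons.prems(3)[of k] in \<open>auto simp: indicator_def\<close>)
  then have "(\<Sum>p\<in>set (k # S). \<integral>\<^sup>+x. h x * indicator (hbox p) x \<partial>lborel)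
    \<le> 2 * (\<integral>\<^sup>+x. H x * indicator F x \<partial>lborel) + 2 * (\<integral>\<^sup>+x. H x * indicator \<Omega> x \<partial>lborel)"
    using Cons.prems(1) IH by (simp add: add_mono)
  also have "\<dots> = 2 * (\<integral>\<^sup>+x. H x * indicator F x + H x * indicator \<Omega> x \<partial>lborel)"
    by (subst nn_integral_add) (auto simp: distrib_left)
  also have "\<dots> \<le> 2 * (\<integral>\<^sup>+x. H x * indicator (hbox k \<union> \<Omega>) x \<partial>lborel)"
    using F'(1,2) unfolding \<Omega>_def[symmetric]
    by (intro mult_left_mono nn_integral_mono) (auto simp: indicator_def)
  finally show ?case by (simp add: \<Omega>_def)
qed simp

text \<open>Values of the maximal function up to 1/4 contribute at most 2 * 1/4 times the measure of
  the union, which is the first term. Larger values fall under \<open>maxs_llog\<close> with s =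
  1/4, and \<open>Llog 4\<close> absorbs this s.\<close>

lemma sparse_sum_bound:
  fixes i :: "'n::finite"
  shows "\<exists>C\<ge>0. \<forall>S g. sparse i S \<longrightarrow> (\<forall>p\<in>set S. proper p) \<longrightarrow> g \<in> borel_measurable borel \<longrightarrow> (\<forall>x::real^'n. 0 \<le> g x) \<longrightarrow>
    (\<Sum>p\<in>set S. \<integral>\<^sup>+x. ennreal (g x) * indicator (hbox p) x \<partial>lborel)
    \<le> (\<Sum>p\<in>set S. ennreal (1/2) * emeasure lborel (hbox p)) +
      ennreal C * (\<integral>\<^sup>+x. ennreal (g x * Llog (g x) ^ (CARD('n) - 1)) * indicator (\<Union>p\<in>set S. hbox p) x \<partial>lborel)"
proof -
  obtain js where js: "set js = UNIV - {i}" "distinct js" using finite_distinct_list[of "UNIV - {i}"] by auto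
  define d where "d = CARD('n) - 1"
  have len: "length js = d" using distinct_card[OF js(2)] js(1) by (simp add: d_def)
  obtain C where "C \<ge> 0" and C: "\<And>P g s. finite P \<Longrightarrow> (\<forall>p\<in>P. proper p) \<Longrightarrow> g \<in> borel_measurable borel \<Longrightarrow>
    (\<forall>x::real^'n. 0 \<le> g x) \<Longrightarrow> s > 0 \<Longrightarrow>
    (\<integral>\<^sup>+x. maxs P js (\<lambda>x. ennreal (g x)) x * indicator {ennreal s<..} (maxs P js (\<lambda>x. ennreal (g x)) x) \<partial>lborel)
    \<le> ennreal C * (\<integral>\<^sup>+x. ennreal (g x * Llog (g x / s) ^ d * indicator {s / 2 ^ d<..} (g x)) \<partial>lborel)"
    using maxs_llog[of js] unfolding len by blast
  define C' where "C' = 2 * C * Llog 4 ^ d"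
  have "(\<Sum>p\<in>set S. \<integral>\<^sup>+x. ennreal (g x) * indicator (hbox p) x \<partial>lborel)
    \<le> (\<Sum>p\<in>set S. ennreal (1/2) * emeasure lborel (hbox p)) +
      ennreal C' * (\<integral>\<^sup>+x. ennreal (g x * Llog (g x) ^ d) * indicator (\<Union>p\<in>set S. hbox p) x \<partial>lborel)"
    if S: "sparse i S" "\<forall>p\<in>set S. proper p" and g [measurable]: "g \<in> borel_measurable borel"
      and g0: "\<forall>x::real^'n. 0 \<le> g x" for S g
  proof -
    define \<Omega> where "\<Omega> = (\<Union>p\<in>set S. hbox p)"
    have [measurable]: "\<Omega> \<in> sets borel" unfolding \<Omega>_def by (rule UN_hbox_measurable) simp
    \<comment> \<open>The cut-off leaves the left side unchanged and confines the right side to the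
      union, which is what \<open>layer_cake_sum\<close> needs.\<close>
    define g' where "g' x = g x * indicator \<Omega> x" for x
    have g' [measurable]: "g' \<in> borel_measurable borel" unfolding g'_def by measurable
    have g'0: "\<forall>x. 0 \<le> g' x" using g0 by (simp add: g'_def)
    define H where "H = maxs (set S) js (\<lambda>x. ennreal (g' x))"
    have [measurable]: "H \<in> borel_measurable borel" unfolding H_def by (intro maxs_measurable) auto
    have "(\<Sum>p\<in>set S. \<integral>\<^sup>+x. ennreal (g x) * indicator (hbox p) x \<partial>lborel)
       = (\<Sum>p\<in>set S. \<integral>\<^sup>+x. ennreal (g' x) * indicator (hbox p) x \<partial>lborel)"
      by (intro sum.cong refl nn_integral_cong) (auto simp: g'_def \<Omega>_def indicator_def)
    also have "\<dots> \<le> 2 * (\<integral>\<^sup>+x. H x * indicator \<Omega> x \<partial>lborel)"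
      unfolding \<Omega>_def
      by (rule sparse_sum_le_maximal[OF S _ _ js(1)]) (auto simp: H_def intro!: avgs_le_maxs)
    also have "\<dots> \<le> 2 * (\<integral>\<^sup>+x. ennreal (1/4) * indicator \<Omega> x + H x * indicator {ennreal (1/4)<..} (H x) \<partial>lborel)"
      by (intro mult_left_mono nn_integral_mono) (auto simp: indicator_def not_less)
    also have "\<dots> = 2 * (ennreal (1/4) * emeasure lborel \<Omega> + (\<integral>\<^sup>+x. H x * indicator {ennreal (1/4)<..} (H x) \<partial>lborel))"
      by (subst nn_integral_add) (auto simp: nn_integral_cmult_indicator)
    also have "\<dots> \<le> 2 * (ennreal (1/4) * (\<Sum>p\<in>set S. emeasure lborel (hbox p)) +
        ennreal C * (\<integral>\<^sup>+x. ennreal (g' x * Llog (g' x / (1/4)) ^ d * indicator {1/4 / 2 ^ d<..} (g' x)) \<partial>lborel))"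
      unfolding H_def
    proof (intro mult_left_mono add_mono C)
      show "emeasure lborel \<Omega> \<le> (\<Sum>p\<in>set S. emeasure lborel (hbox p))"
        unfolding \<Omega>_def by (intro emeasure_subadditive_finite) auto
    qed (use S g'0 in auto)
    also have "\<dots> \<le> 2 * (ennreal (1/4) * (\<Sum>p\<in>set S. emeasure lborel (hbox p)) +
        ennreal C * (\<integral>\<^sup>+x. ennreal (Llog 4 ^ d) * (ennreal (g x * Llog (g x) ^ d) * indicator \<Omega> x) \<partial>lborel))"
    proof (intro mult_left_mono add_left_mono nn_integral_mono)
      fix x
      show "ennreal (g' x * Llog (g' x / (1/4)) ^ d * indicator {1/4 / 2 ^ d<..} (g' x))
        \<le> ennreal (Llog 4 ^ d) * (ennreal (g x * Llog (g x) ^ d) * indicator \<Omega> x)"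
      proof (cases "x \<in> \<Omega>")
        case True
        have "Llog (4 * g x) ^ d \<le> (Llog 4 * Llog (g x)) ^ d"
          using g0 Llog_ge_1[of "4 * g x"] by (intro power_mono Llog_mult_le) auto
        then have "g x * Llog (4 * g x) ^ d * indicator {1/4 / 2 ^ d<..} (g x) \<le> g x * (Llog 4 * Llog (g x)) ^ d * 1"
          using g0 Llog_ge_1[of "4 * g x"] Llog_ge_1[of 4] Llog_ge_1[of "g x"]
          by (intro mult_mono mult_left_mono) (auto simp: indicator_def)
        also have "\<dots> = Llog 4 ^ d * (g x * Llog (g x) ^ d)"
          by (simp add: power_mult_distrib mult_ac)
        finally have "ennreal (g x * Llog (4 * g x) ^ d * indicator {1/4 / 2 ^ d<..} (g x))
          \<le> ennreal (Llog 4 ^ d * (g x * Llog (g x) ^ d))" by (rule ennreal_leI)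
        also have "\<dots> = ennreal (Llog 4 ^ d) * ennreal (g x * Llog (g x) ^ d)"
          using g0 Llog_ge_1[of 4] Llog_ge_1[of "g x"] by (intro ennreal_mult) auto
        finally show ?thesis using True by (simp add: g'_def mult.commute)
      qed (simp add: g'_def)
    qed auto
    also have "\<dots> = 2 * (ennreal (1/4) * (\<Sum>p\<in>set S. emeasure lborel (hbox p))) +
        2 * (ennreal C * (ennreal (Llog 4 ^ d) * (\<integral>\<^sup>+x. ennreal (g x * Llog (g x) ^ d) * indicator \<Omega> x \<partial>lborel)))"
      by (subst nn_integral_cmult) (auto simp: distrib_left)
    also have "2 * (ennreal (1/4) * (\<Sum>p\<in>set S. emeasure lborel (hbox p))) = (\<Sum>p\<in>set S. ennreal (1/2) * emeasure lborel (hbox p))"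
      using ennreal_mult[of 2 "1/4"] by (simp add: sum_distrib_left mult.assoc[symmetric])
    also have "2 * (ennreal C * (ennreal (Llog 4 ^ d) * (\<integral>\<^sup>+x. ennreal (g x * Llog (g x) ^ d) * indicator \<Omega> x \<partial>lborel)))
      = ennreal C' * (\<integral>\<^sup>+x. ennreal (g x * Llog (g x) ^ d) * indicator \<Omega> x \<partial>lborel)"
      using \<open>C \<ge> 0\<close> Llog_ge_1[of 4] by (simp add: C'_def ennreal_mult mult.assoc)
    finally show ?thesis unfolding \<Omega>_def .
  qed
  moreover have "C' \<ge> 0" using \<open>C \<ge> 0\<close> Llog_ge_1[of 4] by (simp add: C'_def)
  ultimately show ?thesis unfolding d_def by blast
qed

text \<open>Integrate \<open>le\<close> over \<open>t \<ge> 0\<close>. A sum over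
  \<open>t < \<mu> p\<close> becomes a sum weighted by \<open>\<mu> p\<close>; for fixed
  \<open>x\<close> the levels \<open>t\<close> at which \<open>x\<close> lies in the union fill at
  most an interval up to the largest \<open>\<mu> p\<close> with \<open>x\<close> in the box. For
  \<open>\<mu> p\<close> = w(R)/|R| this is a discrete maximal function of w.\<close>

lemma layer_cake_sum:
  fixes \<mu> :: "('n::finite) corners \<Rightarrow> real" and S :: "'n corners set"
  assumes S: "finite S" and \<mu>: "\<And>p. p \<in> S \<Longrightarrow> 0 \<le> \<mu> p" and G [measurable]: "G \<in> borel_measurable borel"
    and le: "\<And>t. (\<Sum>p\<in>{p\<in>S. t < \<mu> p}. a p) \<le> (\<Sum>p\<in>{p\<in>S. t < \<mu> p}. b p) +
      (\<integral>\<^sup>+x. G x * indicator (\<Union>p\<in>{p\<in>S. t < \<mu> p}. hbox p) x \<partial>lborel)"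
  shows "(\<Sum>p\<in>S. ennreal (\<mu> p) * a p) \<le> (\<Sum>p\<in>S. ennreal (\<mu> p) * b p) +
      (\<integral>\<^sup>+x. G x * (SUP p\<in>S. indicator (hbox p) x * ennreal (\<mu> p)) \<partial>lborel)"
proof -
  have cake: "(\<integral>\<^sup>+t. (\<Sum>p\<in>{p\<in>S. t < \<mu> p}. c p) * indicator {0..} t \<partial>lborel) = (\<Sum>p\<in>S. ennreal (\<mu> p) * c p)" for c :: "'n corners \<Rightarrow> ennreal"
  proof -
    have "(\<Sum>p\<in>{p\<in>S. t < \<mu> p}. c p) * indicator {0..} t = (\<Sum>p\<in>S. c p * indicator {0..<\<mu> p} t)" for t
      unfolding sum.inter_filter[OF S]
      by (cases "t \<ge> 0") (auto simp: indicator_def intro!: sum.cong)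
    then have "(\<integral>\<^sup>+t. (\<Sum>p\<in>{p\<in>S. t < \<mu> p}. c p) * indicator {0..} t \<partial>lborel) = (\<Sum>p\<in>S. \<integral>\<^sup>+t. c p * indicator {0..<\<mu> p} t \<partial>lborel)"
      by (simp add: nn_integral_sum)
    also have "\<dots> = (\<Sum>p\<in>S. ennreal (\<mu> p) * c p)"
      using \<mu> by (intro sum.cong refl) (simp add: nn_integral_cmult_indicator mult.commute)
    finally show ?thesis .
  qed
  \<comment> \<open>Region under the graph of that largest \<open>\<mu> p\<close>; the two
    integrations are exchanged over it.\<close>
  define A where "A = {z::(real^'n) \<times> real. 0 \<le> snd z \<and> (\<exists>p\<in>S. fst z \<in> hbox p \<and> snd z < \<mu> p)}"
  have [measurable]: "A \<in> sets (borel \<Otimes>\<^sub>M borel)"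
  proof -
    have "A = {z\<in>space (borel \<Otimes>\<^sub>M borel). 0 \<le> snd z \<and> (\<exists>p\<in>S. fst z \<in> hbox p \<and> snd z < \<mu> p)}"
      by (simp add: A_def space_pair_measure)
    also have "\<dots> \<in> sets (borel \<Otimes>\<^sub>M borel)" using S by measurable
    finally show ?thesis .
  qed
  have "(\<Sum>p\<in>S. ennreal (\<mu> p) * a p) = (\<integral>\<^sup>+t. (\<Sum>p\<in>{p\<in>S. t < \<mu> p}. a p) * indicator {0..} t \<partial>lborel)"
    by (rule cake[symmetric])
  also have "\<dots> \<le> (\<integral>\<^sup>+t. (\<Sum>p\<in>{p\<in>S. t < \<mu> p}. b p) * indicator {0..} t +
      (\<integral>\<^sup>+x. G x * indicator A (x, t) \<partial>lborel) \<partial>lborel)"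
  proof (intro nn_integral_mono)
    fix t :: real
    have "(\<integral>\<^sup>+x. G x * indicator (\<Union>p\<in>{p\<in>S. t < \<mu> p}. hbox p) x \<partial>lborel) = (\<integral>\<^sup>+x. G x * indicator A (x, t) \<partial>lborel)" if "t \<ge> 0"
      using that by (intro nn_integral_cong) (auto simp: A_def indicator_def)
    then show "(\<Sum>p\<in>{p\<in>S. t < \<mu> p}. a p) * indicator {0..} t
      \<le> (\<Sum>p\<in>{p\<in>S. t < \<mu> p}. b p) * indicator {0..} t + (\<integral>\<^sup>+x. G x * indicator A (x, t) \<partial>lborel)"
      using le[of t] by (cases "t \<ge> 0") auto
  qed
  also have "\<dots> = (\<integral>\<^sup>+t. (\<Sum>p\<in>{p\<in>S. t < \<mu> p}. b p) * indicator {0..} t \<partial>lborel) +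
      (\<integral>\<^sup>+t. (\<integral>\<^sup>+x. G x * indicator A (x, t) \<partial>lborel) \<partial>lborel)"
  proof (intro nn_integral_add)
    have "(\<Sum>p\<in>{p\<in>S. t < \<mu> p}. b p) = (\<Sum>p\<in>S. b p * indicator {..<\<mu> p} t)" for t
      unfolding sum.inter_filter[OF S] by (auto simp: indicator_def intro!: sum.cong)
    then show "(\<lambda>t. (\<Sum>p\<in>{p\<in>S. t < \<mu> p}. b p) * indicator {0..} t) \<in> borel_measurable lborel"
      by simp
  qed measurable
  also have "(\<integral>\<^sup>+t. (\<integral>\<^sup>+x. G x * indicator A (x, t) \<partial>lborel) \<partial>lborel) = (\<integral>\<^sup>+x. (\<integral>\<^sup>+t. G x * indicator A (x, t) \<partial>lborel) \<partial>lborel)"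
    by (rule lborel_pair.Fubini') measurable
  also have "\<dots> \<le> (\<integral>\<^sup>+x. G x * (SUP p\<in>S. indicator (hbox p) x * ennreal (\<mu> p)) \<partial>lborel)"
  proof (intro nn_integral_mono)
    fix x :: "real^'n"
    define M where "M = (SUP p\<in>S. indicator (hbox p) x * ennreal (\<mu> p))"
    have "emeasure lborel {t. (x, t) \<in> A} \<le> M"
    proof (cases M)
      case (real r)
      have "{t. (x, t) \<in> A} \<subseteq> {0..<r}"
      proof
        fix t assume "t \<in> {t. (x, t) \<in> A}"
        then obtain p where p: "0 \<le> t" "p \<in> S" "x \<in> hbox p" "t < \<mu> p" by (auto simp: A_def)
        have "ennreal (\<mu> p) = indicator (hbox p) x * ennreal (\<mu> p)" using p by simp
        also have "\<dots> \<le> M" unfolding M_def using p(2) by (rule SUP_upper)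
        finally have "\<mu> p \<le> r" using real by simp
        then show "t \<in> {0..<r}" using p by simp
      qed
      then have "emeasure lborel {t. (x, t) \<in> A} \<le> emeasure lborel {0..<r}" by (rule emeasure_mono) simp
      then show ?thesis using real by simp
    qed simp
    moreover have "(\<integral>\<^sup>+t. G x * indicator A (x, t) \<partial>lborel) = G x * emeasure lborel {t. (x, t) \<in> A}"
    proof -
      have m: "{t. (x, t) \<in> A} \<in> sets lborel" using measurable_Pair1'[of x borel borel] by measurable
      have "(\<integral>\<^sup>+t. G x * indicator A (x, t) \<partial>lborel) = (\<integral>\<^sup>+t. G x * indicator {t. (x, t) \<in> A} t \<partial>lborel)"
        by (simp add: indicator_def)
      then show ?thesis using m by (simp only: nn_integral_cmult_indicator)
    qed
    ultimately show "(\<integral>\<^sup>+t. G x * indicator A (x, t) \<partial>lborel) \<le> G x * (SUP p\<in>S. indicator (hbox p) x * ennreal (\<mu> p))"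
      unfolding M_def[symmetric] by (simp only: mult_left_mono zero_le)
  qed
  finally show ?thesis by (simp add: cake add_left_mono)
qed

lemma absorb_half:
  fixes X Y :: ennreal
  assumes "X \<le> ennreal (1/2) * X + Y" "X \<noteq> \<infinity>"
  shows "X \<le> 2 * Y"
proof (cases X)
  case (real r)
  show ?thesis
  proof (cases Y)
    case (real y)
    have "ennreal (1/2) * ennreal r = ennreal (1/2 * r)"
      by (rule ennreal_mult[symmetric]) (use \<open>0 \<le> r\<close> in auto)
    moreover have "ennreal (1/2 * r) + ennreal y = ennreal (1/2 * r + y)"
      by (rule ennreal_plus[symmetric]) (use \<open>0 \<le> r\<close> \<open>0 \<le> y\<close> in auto)
    ultimately have "ennreal r \<le> ennreal (1/2 * r + y)"
      using assms(1) unfolding \<open>X = ennreal r\<close> \<open>Y = ennreal y\<close> by (simp only:)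
    then have "r \<le> 1/2 * r + y"
      by (rule ennreal_le_iff[THEN iffD1, rotated]) (use \<open>0 \<le> r\<close> \<open>0 \<le> y\<close> in auto)
    then have "r \<le> 2 * y" by simp
    then show ?thesis using real \<open>X = ennreal r\<close> ennreal_mult[of 2 y] ennreal_leI[of r "2*y"] by simp
  qed (simp add: ennreal_mult_top)
qed (use assms in simp)

text \<open>Let \<open>X\<close> be the sum of \<open>N\<close> over the selected boxes. Averages of
  \<open>g\<close> are at least 1, so \<open>layer_cake_sum\<close> gives \<open>X\<close> at most
  \<open>X / 2\<close> plus \<open>C * I\<close>, and \<open>X\<close> is finite. Selected boxes
  contribute at most \<open>X\<close>; rejected ones are half covered by dilates and contribute at
  most \<open>D1 * D2 * X\<close>.\<close>

lemma finite_family_bound: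
  fixes N :: "(real ^ 'n) measure"
  assumes "ainf N"
  shows "\<exists>C\<ge>0. \<forall>P g. finite P \<longrightarrow> (\<forall>p\<in>P. proper p) \<longrightarrow> g \<in> borel_measurable borel \<longrightarrow> (\<forall>x. 0 \<le> g x) \<longrightarrow>
    (\<forall>p\<in>P. emeasure lborel (hbox p) \<le> (\<integral>\<^sup>+x. ennreal (g x) * indicator (hbox p) x \<partial>lborel)) \<longrightarrow>
    emeasure N (\<Union>p\<in>P. hbox p) \<le> ennreal C * (\<integral>\<^sup>+x. ennreal (g x * Llog (g x) ^ (CARD('n) - 1)) *
      (SUP p\<in>P. indicator (hbox p) x * (emeasure N (hbox p) / emeasure lborel (hbox p))) \<partial>lborel)"
proof -
  define i where "i = (SOME i::'n. True)"
  define d where "d = CARD('n) - 1"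
  have N: "sets N = sets borel" and fin: "\<And>p. emeasure N (hbox p) < \<infinity>" using assms by (auto simp: ainf_def)
  obtain D1 where "D1 \<ge> 0" and D1: "\<And>P Q. finite P \<Longrightarrow> (\<forall>p\<in>P. proper p) \<Longrightarrow> finite Q \<Longrightarrow>
    (\<forall>p\<in>P. emeasure lborel (hbox p) \<le> 2 * emeasure lborel (hbox p \<inter> (\<Union>q\<in>Q. hbox q))) \<Longrightarrow>
    emeasure N (\<Union>p\<in>P. hbox p) \<le> ennreal D1 * emeasure N (\<Union>q\<in>Q. hbox q)"
    using density_cover_bound[OF assms] by blast
  \<comment> \<open>A box fills one third of its dilate, so \<open>D2\<close> is the doubling
    constant for \<open>star\<close>.\<close>
  have "(1/3::real) > 0" by simp
  then obtain D2 where "D2 \<ge> 0" and D2: "\<And>p E. proper p \<Longrightarrow> E \<in> sets borel \<Longrightarrow> E \<subseteq> hbox p \<Longrightarrow>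
      ennreal (1/3) * emeasure lborel (hbox p) \<le> emeasure lborel E \<Longrightarrow> emeasure N (hbox p) \<le> ennreal D2 * emeasure N E"
    using assms unfolding ainf_def by blast
  obtain C where "C \<ge> 0" and C: "\<And>S g. sparse i S \<Longrightarrow> (\<forall>p\<in>set S. proper p) \<Longrightarrow> g \<in> borel_measurable borel \<Longrightarrow> (\<forall>x::real^'n. 0 \<le> g x) \<Longrightarrow>
    (\<Sum>p\<in>set S. \<integral>\<^sup>+x. ennreal (g x) * indicator (hbox p) x \<partial>lborel)
    \<le> (\<Sum>p\<in>set S. ennreal (1/2) * emeasure lborel (hbox p)) +
      ennreal C * (\<integral>\<^sup>+x. ennreal (g x * Llog (g x) ^ d) * indicator (\<Union>p\<in>set S. hbox p) x \<partial>lborel)"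
    using sparse_sum_bound[of i] unfolding d_def by blast
  define C' where "C' = (1 + D1 * D2) * (2 * C)"
  have "emeasure N (\<Union>p\<in>P. hbox p) \<le> ennreal C' * (\<integral>\<^sup>+x. ennreal (g x * Llog (g x) ^ d) *
      (SUP p\<in>P. indicator (hbox p) x * (emeasure N (hbox p) / emeasure lborel (hbox p))) \<partial>lborel)"
    if P: "finite P" "\<forall>p\<in>P. proper p" and g [measurable]: "g \<in> borel_measurable borel" and g0: "\<forall>x. 0 \<le> g x"
      and avg: "\<forall>p\<in>P. emeasure lborel (hbox p) \<le> (\<integral>\<^sup>+x. ennreal (g x) * indicator (hbox p) x \<partial>lborel)" for P g
  proof -
    obtain xs0 where xs0: "set xs0 = P" "distinct xs0" using finite_distinct_list[OF P(1)] by blast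
    define xs where "xs = sort_key (\<lambda>p. len p i) xs0"
    have xs: "set xs = P" "distinct xs" "sorted_wrt (\<lambda>p q. len p i \<le> len q i) xs"
      using xs0 sorted_sort_key[of "\<lambda>p. len p i" xs0] by (auto simp: xs_def sorted_map)
    obtain S where S: "set S \<subseteq> P" "sparse i S" "\<forall>p\<in>P - set S.
      emeasure lborel (hbox p) \<le> 2 * emeasure lborel (hbox p \<inter> (\<Union>j\<in>set S. hbox (star j i)))"
      using sparse_selection[OF xs(2,3)] unfolding xs(1) by blast
    have prS: "proper p" if "p \<in> set S" for p using that S(1) P(2) by blast
    define v where "v p = emeasure lborel (hbox p)" for p :: "'n corners"
    define \<mu> where "\<mu> p = enn2real (emeasure N (hbox p) / v p)" for p
    have v: "v p \<noteq> 0" "v p \<noteq> \<infinity>" if "p \<in> P" for p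
      using that P(2) emeasure_hbox_pos[of p] emeasure_hbox_finite[of p] by (auto simp: v_def)
    have \<mu>: "ennreal (\<mu> p) = emeasure N (hbox p) / v p" if "p \<in> P" for p
    proof -
      have "emeasure N (hbox p) / v p < \<infinity>"
        using v[OF that] fin[of p]
        by (cases "emeasure N (hbox p)"; cases "v p") (auto simp: divide_ennreal)
      then show ?thesis by (simp add: \<mu>_def ennreal_enn2real)
    qed
    have \<mu>v: "ennreal (\<mu> p) * v p = emeasure N (hbox p)" if "p \<in> P" for p
      using v[OF that] \<mu>[OF that]
      by (cases "v p") (auto simp: ennreal_divide_times divide_ennreal)
    define X where "X = (\<Sum>p\<in>set S. emeasure N (hbox p))"
    define M where "M x = (SUP p\<in>P. indicator (hbox p) x * (emeasure N (hbox p) / v p))" for x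
    define I where "I = (\<integral>\<^sup>+x. ennreal (g x * Llog (g x) ^ d) * M x \<partial>lborel)"
    define G where "G x = ennreal C * ennreal (g x * Llog (g x) ^ d)" for x
    have G [measurable]: "G \<in> borel_measurable borel" unfolding G_def by measurable
    have Xfin: "X \<noteq> \<infinity>" using fin by (simp add: X_def less_top)
    have "(\<Sum>p\<in>set S. ennreal (\<mu> p) * (\<integral>\<^sup>+x. ennreal (g x) * indicator (hbox p) x \<partial>lborel))
      \<le> (\<Sum>p\<in>set S. ennreal (\<mu> p) * (ennreal (1/2) * v p)) +
        (\<integral>\<^sup>+x. G x * (SUP p\<in>set S. indicator (hbox p) x * ennreal (\<mu> p)) \<partial>lborel)"
    proof (rule layer_cake_sum)
      fix t
      have "(\<integral>\<^sup>+x. G x * indicator (\<Union>p\<in>set (filter (\<lambda>p. t < \<mu> p) S). hbox p) x \<partial>lborel)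
        = ennreal C * (\<integral>\<^sup>+x. ennreal (g x * Llog (g x) ^ d) * indicator (\<Union>p\<in>set (filter (\<lambda>p. t < \<mu> p) S). hbox p) x \<partial>lborel)"
      proof -
        have [measurable]: "(\<Union>p\<in>set (filter (\<lambda>p. t < \<mu> p) S). hbox p) \<in> sets borel"
          by (rule UN_hbox_measurable) simp
        show ?thesis unfolding G_def mult.assoc by (rule nn_integral_cmult) measurable
      qed
      then show "(\<Sum>p\<in>{p\<in>set S. t < \<mu> p}. \<integral>\<^sup>+x. ennreal (g x) * indicator (hbox p) x \<partial>lborel)
        \<le> (\<Sum>p\<in>{p\<in>set S. t < \<mu> p}. ennreal (1/2) * v p) +
          (\<integral>\<^sup>+x. G x * indicator (\<Union>p\<in>{p\<in>set S. t < \<mu> p}. hbox p) x \<partial>lborel)"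
        using C[OF sparse_filter[OF S(2), of "\<lambda>p. t < \<mu> p"] _ g g0] prS
        by (simp add: v_def)
    qed (auto simp: \<mu>_def)
    also have "(\<Sum>p\<in>set S. ennreal (\<mu> p) * (ennreal (1/2) * v p)) = ennreal (1/2) * X"
      unfolding X_def sum_distrib_left
    proof (intro sum.cong refl)
      fix p assume "p \<in> set S"
      then have "ennreal (\<mu> p) * v p = emeasure N (hbox p)" using \<mu>v S(1) by blast
      then show "ennreal (\<mu> p) * (ennreal (1/2) * v p) = ennreal (1/2) * emeasure N (hbox p)"
        by (metis mult.left_commute)
    qed
    also have "(\<integral>\<^sup>+x. G x * (SUP p\<in>set S. indicator (hbox p) x * ennreal (\<mu> p)) \<partial>lborel) \<le> (\<integral>\<^sup>+x. G x * M x \<partial>lborel)"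
      unfolding M_def
      by (intro nn_integral_mono mult_left_mono SUP_subset_mono S(1)) (use S(1) \<mu> in auto)
    also have "\<dots> = ennreal C * I"
    proof -
      have [measurable]: "M \<in> borel_measurable borel"
        unfolding M_def[abs_def] using P(1) by (intro borel_measurable_SUP countable_finite) measurable
      show ?thesis unfolding G_def I_def mult.assoc by (rule nn_integral_cmult) measurable
    qed
    finally have 1: "(\<Sum>p\<in>set S. ennreal (\<mu> p) * (\<integral>\<^sup>+x. ennreal (g x) * indicator (hbox p) x \<partial>lborel))
      \<le> ennreal (1/2) * X + ennreal C * I" by (simp add: add_left_mono)
    have "X \<le> (\<Sum>p\<in>set S. ennreal (\<mu> p) * (\<integral>\<^sup>+x. ennreal (g x) * indicator (hbox p) x \<partial>lborel))"
      unfolding X_def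
    proof (rule sum_mono)
      fix p assume "p \<in> set S"
      then have "p \<in> P" using S(1) by blast
      then show "emeasure N (hbox p) \<le> ennreal (\<mu> p) * (\<integral>\<^sup>+x. ennreal (g x) * indicator (hbox p) x \<partial>lborel)"
        using avg \<mu>v[of p] by (metis mult_left_mono v_def zero_le)
    qed
    with 1 have "X \<le> ennreal (1/2) * X + ennreal C * I" by (rule order_trans[rotated])
    then have X: "X \<le> 2 * (ennreal C * I)" by (rule absorb_half[OF _ Xfin])
    have st: "emeasure N (hbox (star p i)) \<le> ennreal D2 * emeasure N (hbox p)" if "p \<in> set S" for p
    proof (rule D2)
      have "side p j \<subseteq> side (star p i) j" for j
        using side_subset_star[OF prS[OF that], of i] by (cases "j = i") (auto simp: side_star)
      then show "hbox p \<subseteq> hbox (star p i)" by (auto simp: hbox_def)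
      have "ennreal (1/3) * (3 * emeasure lborel (hbox p)) = emeasure lborel (hbox p)"
        using ennreal_mult[of "1/3" 3] by (simp add: mult.assoc[symmetric])
      then show "ennreal (1/3) * emeasure lborel (hbox (star p i)) \<le> emeasure lborel (hbox p)"
        by (simp add: emeasure_hbox_star prS that)
    qed (simp_all add: proper_star prS that)
    have "emeasure N (\<Union>j\<in>set S. hbox (star j i)) \<le> (\<Sum>j\<in>set S. emeasure N (hbox (star j i)))"
      by (intro emeasure_subadditive_finite) (auto simp: N)
    also have "\<dots> \<le> (\<Sum>j\<in>set S. ennreal D2 * emeasure N (hbox j))"
      by (intro sum_mono st)
    also have "\<dots> = ennreal D2 * X" by (simp add: X_def sum_distrib_left)
    finally have stars: "emeasure N (\<Union>j\<in>set S. hbox (star j i)) \<le> ennreal D2 * X" .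
    have "emeasure N (\<Union>p\<in>P - set S. hbox p) \<le> ennreal D1 * emeasure N (\<Union>q\<in>(\<lambda>j. star j i) ` set S. hbox q)"
      using P S(3) by (intro D1) (simp_all add: image_image)
    also have "\<dots> \<le> ennreal D1 * (ennreal D2 * X)"
      using stars by (intro mult_left_mono) (simp_all add: image_image)
    finally have rest: "emeasure N (\<Union>p\<in>P - set S. hbox p) \<le> ennreal D1 * (ennreal D2 * X)" .
    have sel: "emeasure N (\<Union>p\<in>set S. hbox p) \<le> X"
      unfolding X_def by (intro emeasure_subadditive_finite) (auto simp: N)
    have "(\<Union>p\<in>P. hbox p) = (\<Union>p\<in>set S. hbox p) \<union> (\<Union>p\<in>P - set S. hbox p)"
      unfolding UN_Un[symmetric] by (simp only: Un_Diff_cancel Un_absorb1[OF S(1)])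
    then have "emeasure N (\<Union>p\<in>P. hbox p) \<le> emeasure N (\<Union>p\<in>set S. hbox p) + emeasure N (\<Union>p\<in>P - set S. hbox p)"
      using P(1) by (simp only:) (intro emeasure_subadditive, auto simp: N intro!: UN_hbox_measurable)
    also have "\<dots> \<le> X + ennreal D1 * (ennreal D2 * X)"
      by (rule add_mono[OF sel rest])
    also have "\<dots> = ennreal (1 + D1 * D2) * X"
      using \<open>D1 \<ge> 0\<close> \<open>D2 \<ge> 0\<close> by (simp add: ennreal_mult distrib_right mult.assoc)
    also have "\<dots> \<le> ennreal (1 + D1 * D2) * (2 * (ennreal C * I))"
      by (intro mult_left_mono X) simp
    also have "\<dots> = ennreal C' * I"
      using \<open>D1 \<ge> 0\<close> \<open>D2 \<ge> 0\<close> \<open>C \<ge> 0\<close> by (simp add: C'_def ennreal_mult mult.assoc)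
    finally show ?thesis by (simp add: I_def M_def v_def)
  qed
  moreover have "C' \<ge> 0" using \<open>D1 \<ge> 0\<close> \<open>D2 \<ge> 0\<close> \<open>C \<ge> 0\<close> by (simp add: C'_def)
  ultimately show ?thesis unfolding d_def by blast
qed

section \<open>Strong Muckenhoupt weights and rational boxes\<close>

lemma ennreal_power_measurable [measurable (raw)]:
  assumes [measurable]: "f \<in> borel_measurable M"
  shows "(\<lambda>x. ennreal_power (f x) a) \<in> borel_measurable M"
  unfolding ennreal_power_def by measurable

text \<open>A substitute for Hoelder's inequality: integrated over a subset of a box, with \<open>t\<close> chosen
  so that the last term is half of the measure, it gives the doubling estimate.\<close>
lemma one_le_weight_plus_dual:
  fixes t w q :: real
  assumes "t > 0" "q > 0" "w \<ge> 0"
  shows "1 \<le> ennreal (1 / t) * ennreal w + ennreal (t powr q) * ennreal_power (ennreal w) (- q)"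
proof (cases "w \<ge> t")
  case True
  have "1 \<le> ennreal (1 / t * w)" using True assms by (simp add: field_simps)
  also have "\<dots> = ennreal (1 / t) * ennreal w" using assms by (intro ennreal_mult) auto
  finally show ?thesis by (rule order_trans) simp
next
  case False
  have "1 \<le> ennreal (t powr q) * ennreal_power (ennreal w) (- q)"
  proof (cases "w = 0")
    case True
    then show ?thesis using assms by (simp add: ennreal_power_def ennreal_mult_top)
  next
    case nz: False
    then have w: "w > 0" using assms by simp
    have "1 \<le> (t / w) powr q" using False w assms by (intro ge_one_powr_ge_zero) (auto simp: field_simps)
    also have "\<dots> = t powr q * w powr (- q)" using w assms by (simp add: powr_divide powr_minus_divide)
    finally have "ennreal 1 \<le> ennreal (t powr q * w powr (- q))" by (rule ennreal_leI)
    also have "\<dots> = ennreal (t powr q) * ennreal (w powr (- q))" by (intro ennreal_mult) auto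
    also have "\<dots> = ennreal (t powr q) * ennreal_power (ennreal w) (- q)"
      using w assms by (simp add: ennreal_power_def)
    finally show ?thesis by simp
  qed
  then show ?thesis by (rule order_trans) simp
qed

text \<open>With q = 1 / (p - 1) the dual weight is w to the power -q. After the choice of
  \<open>t\<close> the Muckenhoupt bound turns into the constant
  \<open>K / (c / 2) powr p\<close>.\<close>

lemma ainf_density:
  fixes w :: "real ^ 'n \<Rightarrow> real"
  assumes w [measurable]: "w \<in> borel_measurable borel" and w0: "\<And>x. 0 \<le> w x" and p: "p > 1" and K: "K \<ge> 0"
    and fin: "\<And>b. (\<integral>\<^sup>+x. ennreal (w x) * indicator (hbox b) x \<partial>lborel) < \<infinity>"
    and Ap: "\<And>b. proper b \<Longrightarrow>
      (\<integral>\<^sup>+x. ennreal (w x) * indicator (hbox b) x \<partial>lborel) / emeasure lborel (hbox b) *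
      ennreal_power ((\<integral>\<^sup>+x. ennreal_power (ennreal (w x)) (1 - p / (p - 1)) * indicator (hbox b) x \<partial>lborel)
        / emeasure lborel (hbox b)) (p - 1) \<le> ennreal K"
  shows "ainf (density lborel (\<lambda>x. ennreal (w x)))"
proof -
  define N where "N = density lborel (\<lambda>x. ennreal (w x))"
  have N: "emeasure N E = (\<integral>\<^sup>+x. ennreal (w x) * indicator E x \<partial>lborel)" if "E \<in> sets borel" for E
    unfolding N_def using that by (subst emeasure_density) auto
  define q where "q = 1 / (p - 1)"
  have q: "q > 0" "q * (p - 1) = 1" and pq: "1 - p / (p - 1) = - q"
    using p by (auto simp: q_def field_simps)
  have "emeasure N (hbox b) \<le> ennreal (K / (c / 2) powr p + 1) * emeasure N E"
    if c: "c > 0" and b: "proper b" and E [measurable]: "E \<in> sets borel" and Eb: "E \<subseteq> hbox b"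
      and cE: "ennreal c * emeasure lborel (hbox b) \<le> emeasure lborel E" for c b E
  proof -
    define D where "D = K / (c / 2) powr p"
    have D: "D \<ge> 0" using K by (simp add: D_def)
    obtain v where v: "v > 0" "emeasure lborel (hbox b) = ennreal v"
      using emeasure_hbox[OF b] len_pos[OF b] by (metis prod_pos)
    obtain W where W: "W \<ge> 0" "emeasure N (hbox b) = ennreal W"
      using fin[of b] N[of "hbox b"] by (cases "emeasure N (hbox b)") auto
    have "emeasure N E \<le> emeasure N (hbox b)"
      using Eb by (intro emeasure_mono) (auto simp: N_def)
    then obtain e where e: "e \<ge> 0" "emeasure N E = ennreal e"
      using W by (cases "emeasure N E") (auto simp: top_unique)
    define S where "S = (\<integral>\<^sup>+x. ennreal_power (ennreal (w x)) (- q) * indicator (hbox b) x \<partial>lborel)"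
    have Ap': "ennreal W / ennreal v * ennreal_power (S / ennreal v) (p - 1) \<le> ennreal K"
      using Ap[OF b] W v N[of "hbox b"] by (simp add: S_def pq)
    show ?thesis
    proof (cases S)
      case top
      \<comment> \<open>An infinite dual average times a positive average would be infinite, against
        the Muckenhoupt bound.\<close>
      have "W = 0"
      proof (rule ccontr)
        assume "W \<noteq> 0"
        then have "ennreal W / ennreal v \<noteq> 0" using W v by (simp add: divide_ennreal)
        then show False using Ap' top p v by (simp add: ennreal_power_def ennreal_top_divide ennreal_mult_top top_unique)
      qed
      then show ?thesis using W by simp
    next
      case (real s)
      have main: "c * v \<le> e / t + t powr q * s" if t: "t > 0" for t
      proof -
        have "ennreal (c * v) \<le> emeasure lborel E"
          using cE v c by (simp add: ennreal_mult)
        also have "\<dots> = (\<integral>\<^sup>+x. 1 * indicator E x \<partial>lborel)" by simp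
        also have "\<dots> \<le> (\<integral>\<^sup>+x. ennreal (1 / t) * (ennreal (w x) * indicator E x) +
            ennreal (t powr q) * (ennreal_power (ennreal (w x)) (- q) * indicator (hbox b) x) \<partial>lborel)"
        proof (intro nn_integral_mono)
          fix x
          show "1 * indicator E x \<le> ennreal (1 / t) * (ennreal (w x) * indicator E x) +
            ennreal (t powr q) * (ennreal_power (ennreal (w x)) (- q) * indicator (hbox b) x)"
            using one_le_weight_plus_dual[OF t q(1) w0[of x]] Eb
            by (cases "x \<in> E") (auto simp: subset_iff)
        qed
        also have "\<dots> = ennreal (1 / t) * emeasure N E + ennreal (t powr q) * S"
          by (subst nn_integral_add) (auto simp: nn_integral_cmult N S_def)
        also have "\<dots> = ennreal (e / t + t powr q * s)"
          using e real t by (simp add: ennreal_mult[symmetric] ennreal_plus[symmetric] del: ennreal_plus)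
        finally show ?thesis
          by (rule ennreal_le_iff[THEN iffD1, rotated]) (use e real t in auto)
      qed
      have "W \<le> (D + 1) * e"
      proof (cases "s = 0")
        case True
        \<comment> \<open>In the degenerate case \<open>s = 0\<close> the parameter is free; this
          value forces \<open>W + 1 \<le> e\<close>. The constant \<open>D + 1\<close> instead of
          \<open>D\<close> is there for this case.\<close>
        define t where "t = (W + 1) / (c * v)"
        have t: "t > 0" using c v W by (simp add: t_def)
        have "c * v \<le> e / t" using main[OF t] True by simp
        then have "c * v * t \<le> e" using t by (simp add: pos_le_divide_eq)
        moreover have "c * v * t = W + 1" using c v by (simp add: t_def)
        ultimately have "W + 1 \<le> e" by simp
        moreover have "0 \<le> D * e" using D e by simp
        ultimately show ?thesis by (simp add: algebra_simps)
      next
        case False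
        then have s: "s > 0" using real by simp
        \<comment> \<open>Solves \<open>t powr q * s = c * v / 2\<close>, because
          \<open>q * (p - 1) = 1\<close>.\<close>
        define t where "t = (c * v / (2 * s)) powr (p - 1)"
        have t: "t > 0" using s c v by (simp add: t_def)
        have tq: "t powr q = c * v / (2 * s)"
          unfolding t_def powr_powr using q s c v by (simp add: mult.commute)
        have "c * v \<le> e / t + c * v / 2" using main[OF t] tq s by simp
        then have 1: "t * (c * v / 2) \<le> e" using t by (simp add: field_simps)
        have "ennreal W / ennreal v * ennreal_power (S / ennreal v) (p - 1) = ennreal (W / v * (s / v) powr (p - 1))"
          using W v real s p by (simp add: divide_ennreal ennreal_power_def ennreal_mult[symmetric])
        then have 2: "W / v * (s / v) powr (p - 1) \<le> K"
          using Ap' K by simp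
        have 3: "t * (c / 2) * (s / v) powr (p - 1) = (c / 2) powr p"
        proof -
          have "t * (s / v) powr (p - 1) = (c * v / (2 * s) * (s / v)) powr (p - 1)"
            unfolding t_def using s v c by (intro powr_mult[symmetric])
          also have "c * v / (2 * s) * (s / v) = c / 2" using s v by simp
          finally have "t * (c / 2) * (s / v) powr (p - 1) = (c / 2) * (c / 2) powr (p - 1)" by (simp add: mult_ac)
          also have "\<dots> = (c / 2) powr (1 + (p - 1))"
            unfolding powr_add using c by simp
          finally show ?thesis by simp
        qed
        have "W * (c / 2) powr p = (W / v * (s / v) powr (p - 1)) * (t * (c * v / 2))"
          unfolding 3[symmetric] using v by (simp add: field_simps)
        also have "\<dots> \<le> K * e"
          by (rule mult_mono[OF 2 1]) (use K t c v in auto)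
        finally have "W \<le> D * e" using c by (simp add: D_def field_simps)
        then show ?thesis using e by (simp add: distrib_right)
      qed
      then have "ennreal W \<le> ennreal ((D + 1) * e)" by (rule ennreal_leI)
      also have "\<dots> = ennreal (D + 1) * ennreal e" using D e by (intro ennreal_mult) auto
      finally show ?thesis using W e by (simp add: D_def)
    qed
  qed
  moreover have "K / (c / 2) powr p + 1 \<ge> 0" for c using K by simp
  moreover have "emeasure N (hbox b) < \<infinity>" for b using fin[of b] by (simp add: N)
  moreover have "sets N = sets borel" by (simp add: N_def)
  ultimately show ?thesis unfolding ainf_def N_def[symmetric] by blast
qed

text \<open>Holds for arbitrary \<open>S\<close> and \<open>h\<close>: the integral is a supremum
  over measurable simple functions below the integrand, and completion alters these only on null
  sets.\<close>

lemma set_lebesgue_integral_eq_lborel: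
  "(\<integral>\<^sup>+x\<in>S. h x \<partial>lebesgue) = (\<integral>\<^sup>+x. h x * indicator S x \<partial>lborel)"
  by (rule nn_integral_completion)

text \<open>Slicing needs Borel functions. \<open>f\<close> is the pointwise limit of its
  restrictions to balls, hence Lebesgue measurable, hence almost everywhere equal to a Borel
  function.\<close>

lemma locally_integrable_borel_version:
  fixes f :: "real ^ 'n \<Rightarrow> real"
  assumes "locally_integrable f"
  shows "\<exists>g. g \<in> borel_measurable borel \<and> (\<forall>x. 0 \<le> g x) \<and> (AE x in lborel. \<bar>f x\<bar> = g x)"
proof -
  have meas: "(\<lambda>x. indicator (cball 0 (real m)) x *\<^sub>R f x) \<in> borel_measurable lebesgue" for m
    using assms unfolding locally_integrable_def set_integrable_def
    by (intro borel_measurable_integrable) simp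
  have lim: "(\<lambda>m. indicator (cball 0 (real m)) x *\<^sub>R f x) \<longlonglongrightarrow> f x" for x :: "real^'n"
  proof (rule tendsto_eventually)
    have "\<forall>\<^sub>F m in sequentially. norm x \<le> real m"
      by (rule eventually_sequentiallyI[of "nat \<lceil>norm x\<rceil>"]) linarith
    then show "\<forall>\<^sub>F m in sequentially. indicator (cball 0 (real m)) x *\<^sub>R f x = f x"
      by eventually_elim (simp add: indicator_def)
  qed
  have "f \<in> borel_measurable lebesgue"
    by (rule borel_measurable_LIMSEQ_real[OF lim meas])
  then obtain f' where "f' \<in> borel_measurable lborel" "AE x in lborel. f x = f' x"
    using completion_ex_borel_measurable_real by blast
  then show ?thesis by (intro exI[of _ "\<lambda>x. \<bar>f' x\<bar>"]) auto
qed

lemma hbox_rectangle: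
  assumes "proper b"
  shows "hbox b \<in> rectangles"
proof -
  have "is_interval (side b i) \<and> bounded (side b i) \<and> interior (side b i) \<noteq> {}" for i
    using assms[unfolded proper_def, rule_format, of i] by (auto simp: side_def is_interval_1)
  then show ?thesis unfolding rectangles_def hbox_def by blast
qed

lemma locally_integrable_finite_hbox:
  fixes f :: "real ^ 'n \<Rightarrow> real"
  assumes "locally_integrable f"
  shows "(\<integral>\<^sup>+x. ennreal \<bar>f x\<bar> * indicator (hbox b) x \<partial>lborel) < \<infinity>"
proof -
  have "hbox b \<subseteq> cbox (fst b) (snd b)"
    by (auto simp: hbox_def side_def mem_box_cart less_imp_le)
  then have "(\<integral>\<^sup>+x. ennreal \<bar>f x\<bar> * indicator (hbox b) x \<partial>lborel)
    \<le> (\<integral>\<^sup>+x. ennreal (norm (indicator (cbox (fst b) (snd b)) x *\<^sub>R f x)) \<partial>lborel)"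
    by (intro nn_integral_mono) (auto simp: indicator_def)
  also have "\<dots> = (\<integral>\<^sup>+x. ennreal (norm (indicator (cbox (fst b) (snd b)) x *\<^sub>R f x)) \<partial>lebesgue)"
    by (rule nn_integral_completion[symmetric])
  also have "\<dots> < \<infinity>"
    using assms unfolding locally_integrable_def set_integrable_def
    by (simp add: integrable_iff_bounded)
  finally show ?thesis .
qed

lemma strong_maximal_ge:
  assumes "proper b" "x \<in> hbox b"
  shows "(\<integral>\<^sup>+y. ennreal \<bar>f y\<bar> * indicator (hbox b) y \<partial>lborel) / emeasure lborel (hbox b) \<le> strong_maximal f x"
proof -
  have "average (hbox b) (\<lambda>y. ennreal \<bar>f y\<bar>) \<le> strong_maximal f x"
    unfolding strong_maximal_def using assms hbox_rectangle[OF assms(1)] by (intro SUP_upper) auto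
  then show ?thesis by (simp add: average_def set_lebesgue_integral_eq_lborel)
qed

section \<open>Covering the superlevel set by rational boxes\<close>

definition rational_corners :: "('n::finite) corners set" where
  "rational_corners = {b. \<forall>i. fst b $ i \<in> \<rat> \<and> snd b $ i \<in> \<rat>}"

lemma countable_rational_corners: "countable (rational_corners :: ('n::finite) corners set)"
proof -
  have "countable (\<Pi>\<^sub>E i\<in>(UNIV :: 'n set). \<rat> :: real set)" by (intro countable_PiE) (auto simp: countable_rat)
  then have V: "countable ((\<lambda>f. \<chi> i. f i) ` (\<Pi>\<^sub>E i\<in>(UNIV :: 'n set). \<rat> :: real set))" by (rule countable_image)
  have "x \<in> (\<lambda>f. \<chi> i. f i) ` (\<Pi>\<^sub>E i\<in>(UNIV :: 'n set). \<rat> :: real set)" if "\<And>i. x $ i \<in> \<rat>" for x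
    using that by (intro image_eqI[of _ _ "\<lambda>i. x $ i"]) auto
  then have "rational_corners \<subseteq> ((\<lambda>f. \<chi> i. f i) ` (\<Pi>\<^sub>E i\<in>(UNIV :: 'n set). \<rat> :: real set)) \<times> ((\<lambda>f. \<chi> i. f i) ` (\<Pi>\<^sub>E i\<in>(UNIV :: 'n set). \<rat> :: real set))"
    unfolding rational_corners_def mem_Times_iff by (simp add: subset_iff mem_Times_iff)
  then show ?thesis using V by (meson countable_SIGMA countable_subset)
qed

text \<open>Each face moves outwards by less than \<open>d\<close> to a rational position; the
  volume is continuous in \<open>d\<close>, so the strict inequality survives for small
  \<open>d\<close>.\<close>

lemma rational_corners_approx:
  fixes a c :: "real ^ 'n"
  assumes "l \<ge> 0" "\<And>i. a $ i \<le> c $ i" "l * (\<Prod>i\<in>UNIV. c $ i - a $ i) < r"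
  shows "\<exists>b\<in>rational_corners. proper b \<and> cbox a c \<subseteq> hbox b \<and> l * (\<Prod>i\<in>UNIV. len b i) < r"
proof -
    have "((\<lambda>d. l * (\<Prod>i\<in>UNIV. c $ i - a $ i + 2 * d)) \<longlongrightarrow> l * (\<Prod>i\<in>UNIV. c $ i - a $ i + 2 * 0)) (at_right 0)"
      by (intro tendsto_intros)
    then have "\<forall>\<^sub>F d in at_right 0. l * (\<Prod>i\<in>UNIV. c $ i - a $ i + 2 * d) < r"
      using assms(3) by (intro order_tendstoD) auto
    moreover have "\<forall>\<^sub>F d in at_right (0::real). d > 0" by (simp add: eventually_at_right_less)
    ultimately have "\<forall>\<^sub>F d in at_right 0. d > 0 \<and> l * (\<Prod>i\<in>UNIV. c $ i - a $ i + 2 * d) < r"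
      by eventually_elim simp
    then obtain d where d: "d > 0" "l * (\<Prod>i\<in>UNIV. c $ i - a $ i + 2 * d) < r"
      using eventually_happens'[OF trivial_limit_at_right_real] by blast
    have "\<exists>y. y \<in> \<rat> \<and> a $ i - d < y \<and> y < a $ i" for i
      using Rats_dense_in_real[of "a $ i - d" "a $ i"] d(1) by auto
    then obtain A where A: "\<And>i. A i \<in> \<rat> \<and> a $ i - d < A i \<and> A i < a $ i" by metis
    have "\<exists>y. y \<in> \<rat> \<and> c $ i < y \<and> y < c $ i + d" for i
      using Rats_dense_in_real[of "c $ i" "c $ i + d"] d(1) by auto
    then obtain B where B: "\<And>i. B i \<in> \<rat> \<and> c $ i < B i \<and> B i < c $ i + d" by metis
    define b where "b = ((\<chi> i. A i) :: real^'n, (\<chi> i. B i) :: real^'n)"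
    have "A i < B i" for i using A[of i] B[of i] assms(2)[of i] by linarith
    then have "proper b" by (simp add: proper_def b_def)
    moreover have "b \<in> rational_corners" using A B by (simp add: rational_corners_def b_def)
    moreover have "cbox a c \<subseteq> hbox b"
    proof
      fix x assume "x \<in> cbox a c"
      then have "a $ i \<le> x $ i" "x $ i \<le> c $ i" for i by (auto simp: mem_box_cart)
      then have "A i \<le> x $ i \<and> x $ i < B i" for i
        using A[of i] B[of i] by (meson less_imp_le le_less_trans order_trans)
      then show "x \<in> hbox b" by (simp add: hbox_def side_def b_def)
    qed
    moreover have "l * (\<Prod>i\<in>UNIV. len b i) \<le> l * (\<Prod>i\<in>UNIV. c $ i - a $ i + 2 * d)"
    proof (intro mult_left_mono prod_mono assms(1))
      fix i show "0 \<le> len b i \<and> len b i \<le> c $ i - a $ i + 2 * d"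
        using A[of i] B[of i] assms(2)[of i] by (simp add: len_def b_def)
    qed
    ultimately show ?thesis using d(2) by (intro bexI[of _ b]) auto
qed

lemma rectangle_between_boxes:
  assumes "R \<in> rectangles"
  shows "\<exists>a c. (\<forall>i. a $ i < c $ i) \<and> box a c \<subseteq> R \<and> R \<subseteq> cbox a c \<and> R \<in> lmeasurable"
proof -
  obtain I where R: "R = {x. \<forall>i. x $ i \<in> I i}"
    and I: "\<And>i. is_interval (I i)" "\<And>i. bounded (I i)" "\<And>i. interior (I i) \<noteq> {}"
    using assms unfolding rectangles_def by auto
  have "\<exists>l u. l < u \<and> {l<..<u} \<subseteq> I i \<and> I i \<subseteq> {l..u}" for i
  proof -
    have ne: "I i \<noteq> {}" using I(3)[of i] interior_subset[of "I i"] by auto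
    have bdd: "bdd_below (I i)" "bdd_above (I i)"
      using I(2)[of i] by (simp_all add: bounded_imp_bdd_below bounded_imp_bdd_above)
    define l u where "l = Inf (I i)" and "u = Sup (I i)"
    have sub: "I i \<subseteq> {l..u}"
      using bdd by (auto simp: l_def u_def intro: cInf_lower cSup_upper)
    have inner: "{l<..<u} \<subseteq> I i"
    proof
      fix t assume t: "t \<in> {l<..<u}"
      then obtain x y where xy: "x \<in> I i" "x < t" "y \<in> I i" "t < y"
        using cInf_lessD[OF ne, of t] less_cSupD[OF ne, of t] by (auto simp: l_def u_def)
      then have "x \<le> t" "t \<le> y" by auto
      with xy(1,3) I(1)[of i] show "t \<in> I i" unfolding is_interval_1 by blast
    qed
    have "l < u"
    proof (rule ccontr)
      assume "\<not> l < u"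
      then have "I i \<subseteq> {u}" using sub by auto
      then have "interior (I i) \<subseteq> interior {u}" by (rule interior_mono)
      then show False using I(3)[of i] by simp
    qed
    then show ?thesis using sub inner by blast
  qed
  then obtain l u where lu: "\<And>i. l i < u i" "\<And>i. {l i<..<u i} \<subseteq> I i" "\<And>i. I i \<subseteq> {l i..u i}"
    by metis
  define a c where "a = (\<chi> i. l i)" and "c = (\<chi> i. u i)"
  have "box a c \<subseteq> R" using lu(2) by (auto simp: R mem_box_cart a_def c_def subset_iff)
  moreover have sub: "R \<subseteq> cbox a c" using lu(3) by (auto simp: R mem_box_cart a_def c_def subset_iff)
  moreover have "R \<in> lmeasurable"
  proof (rule measurable_convex)
    show "bounded R" using sub bounded_cbox bounded_subset by blast
    have "s * x $ i + t * y $ i \<in> I i" if "x $ i \<in> I i" "y $ i \<in> I i" "0 \<le> s" "0 \<le> t" "s + t = 1" for x y i s t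
      using is_interval_convex[OF I(1)[of i]] that unfolding convex_def by simp
    then show "convex R" by (auto simp: convex_def R)
  qed
  ultimately show ?thesis using lu(1) by (intro exI[of _ a] exI[of _ c]) (simp add: a_def c_def)
qed

text \<open>The average over \<open>R\<close> exceeds \<open>l\<close> strictly, which leaves room
  to enlarge \<open>R\<close> to a rational box; the integral of the nonnegative function only
  grows.\<close>

lemma strong_maximal_cover:
  fixes f g :: "real ^ 'n \<Rightarrow> real"
  assumes l: "l > 0" and g: "AE x in lborel. \<bar>f x\<bar> = g x"
    and x: "ennreal l < strong_maximal f x"
  shows "\<exists>b\<in>rational_corners. proper b \<and> x \<in> hbox b \<and>
    ennreal l * emeasure lborel (hbox b) \<le> (\<integral>\<^sup>+x. ennreal (g x) * indicator (hbox b) x \<partial>lborel)"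
proof -
  obtain R where R: "R \<in> rectangles" "x \<in> R" and avg: "ennreal l < average R (\<lambda>y. ennreal \<bar>f y\<bar>)"
    using x by (auto simp: strong_maximal_def less_SUP_iff)
  obtain a c where ac: "\<And>i. a $ i < c $ i" "box a c \<subseteq> R" "R \<subseteq> cbox a c" "R \<in> lmeasurable"
    using rectangle_between_boxes[OF R(1)] by blast
  define V where "V = (\<Prod>i\<in>UNIV. c $ i - a $ i)"
  have V: "V > 0" using ac(1) by (simp add: V_def prod_pos)
  have "emeasure lborel (box a c) = ennreal V"
  proof -
    have "emeasure lborel (box a c) = ennreal (\<Prod>b\<in>Basis. (c - a) \<bullet> b)"
      using ac(1) by (intro emeasure_lborel_box) (auto simp: Basis_vec_def inner_axis less_imp_le)
    also have "(\<Prod>b\<in>Basis. (c - a) \<bullet> b) = (\<Prod>b\<in>(\<lambda>i. axis i 1) ` UNIV. (c - a) \<bullet> b)"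
      by (rule prod.cong) (auto simp: Basis_vec_def)
    also have "\<dots> = V"
      by (subst prod.reindex) (auto simp: inj_on_def axis_eq_axis inner_axis V_def)
    finally show ?thesis .
  qed
  then have "ennreal V = emeasure lebesgue (box a c)" by simp
  also have "emeasure lebesgue (box a c) \<le> emeasure lebesgue R"
    using ac(2,4) by (intro emeasure_mono) auto
  finally have VR: "ennreal V \<le> emeasure lebesgue R" .
  define J where "J = (\<integral>\<^sup>+x. ennreal (g x) * indicator R x \<partial>lborel)"
  have J: "(\<integral>\<^sup>+y\<in>R. ennreal \<bar>f y\<bar> \<partial>lebesgue) = J"
    unfolding set_lebesgue_integral_eq_lborel J_def using g
    by (intro nn_integral_cong_AE) (auto elim!: eventually_mono)
  have "ennreal l * emeasure lebesgue R < J"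
  proof -
    obtain r where r: "emeasure lebesgue R = ennreal r" "r > 0"
    proof (cases "emeasure lebesgue R")
      case (real r)
      then show ?thesis using that[of r] VR V by auto
    next
      case top
      then show ?thesis using fmeasurableD2[OF ac(4)] by blast
    qed
    show ?thesis
      using avg r l unfolding average_def J
      by (cases J) (auto simp: divide_ennreal ennreal_less_iff ennreal_mult[symmetric] field_simps ennreal_mult_less_top)
  qed
  then have "ennreal l * ennreal V < J"
    using VR by (meson le_less_trans mult_left_mono zero_le)
  then have lV: "ennreal (l * V) < J" using l V by (simp add: ennreal_mult)
  then obtain r' where r': "ennreal (l * V) < r'" "r' < J" using dense by blast
  then obtain r where r: "r' = ennreal r" "0 \<le> r" by (cases r') auto
  have "l * V < r" using r' r l V by (simp add: ennreal_less_iff)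
  then obtain b where b: "b \<in> rational_corners" "proper b" "cbox a c \<subseteq> hbox b" "l * (\<Prod>i\<in>UNIV. len b i) < r"
    using rational_corners_approx[of l a c r] l ac(1) by (auto simp: V_def less_imp_le)
  have "ennreal l * emeasure lborel (hbox b) = ennreal (l * (\<Prod>i\<in>UNIV. len b i))"
    using l len_pos[OF b(2)] by (simp add: emeasure_hbox b(2) ennreal_mult prod_nonneg less_imp_le)
  also have "\<dots> \<le> r'" using b(4) r by (simp add: ennreal_leI)
  also have "r' \<le> J" using r' by simp
  also have "J \<le> (\<integral>\<^sup>+x. ennreal (g x) * indicator (hbox b) x \<partial>lborel)"
    unfolding J_def using ac(3) b(3)
    by (intro nn_integral_mono) (auto simp: indicator_def)
  finally show ?thesis using b ac(3) R(2) by blast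
qed

section \<open>Transfer to the given weight and conclusion\<close>

lemma Llog_power_le:
  "Llog t ^ d \<le> 2 ^ d * (1 + log_plus t ^ d)"
proof -
  define a where "a = log_plus t"
  have a: "a \<ge> 0" "Llog t = 1 + a" by (auto simp: a_def log_plus_def Llog_def)
  have "(1 + a) ^ d \<le> (2 * max 1 a) ^ d" using a by (intro power_mono) auto
  also have "\<dots> = 2 ^ d * max 1 a ^ d" by (rule power_mult_distrib)
  also have "max 1 a ^ d \<le> 1 + a ^ d" using a by (simp add: max_def)
  finally show ?thesis by (simp add: a(2) a_def)
qed

text \<open>Averages do not notice the change from \<open>w\<close> to a Borel function equal almost
  everywhere, and half-open boxes are among the rectangles of the supremum.\<close>

lemma strong_A_ainf:
  fixes w :: "real ^ 'n \<Rightarrow> real"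
  assumes "w \<in> strong_A p" "p > 1" and v [measurable]: "v \<in> borel_measurable borel"
    and v0: "\<And>x. 0 \<le> v x" and ae: "AE x in lborel. \<bar>w x\<bar> = v x"
  shows "ainf (density lborel (\<lambda>x. ennreal (v x)))"
proof -
  have w: "\<And>x. 0 \<le> w x" "locally_integrable w" using assms(1) by (auto simp: strong_A_def weight_def)
  have ae': "AE x in lborel. w x = v x" using ae w(1) by simp
  define K where "K = (SUP R \<in> rectangles. average R (\<lambda>x. ennreal (w x)) *
      ennreal_power (average R (\<lambda>x. ennreal_power (ennreal (w x)) (1 - p / (p - 1)))) (p - 1))"
  have "K < \<infinity>" using assms(1) by (simp add: strong_A_def K_def Let_def)
  then obtain k where k: "k \<ge> 0" "K = ennreal k" by (cases K) auto
  show ?thesis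
  proof (rule ainf_density[OF v v0 assms(2) k(1)])
    fix b :: "'n corners"
    have "(\<integral>\<^sup>+x. ennreal (v x) * indicator (hbox b) x \<partial>lborel) = (\<integral>\<^sup>+x. ennreal \<bar>w x\<bar> * indicator (hbox b) x \<partial>lborel)"
      using ae by (intro nn_integral_cong_AE) (auto elim!: eventually_mono)
    then show "(\<integral>\<^sup>+x. ennreal (v x) * indicator (hbox b) x \<partial>lborel) < \<infinity>"
      using locally_integrable_finite_hbox[OF w(2), of b] by simp
  next
    fix b :: "'n corners" assume b: "proper b"
    have "(\<integral>\<^sup>+x. h (v x) * indicator (hbox b) x \<partial>lborel) / emeasure lborel (hbox b) = average (hbox b) (\<lambda>x. h (w x))" for h
    proof -
      have "(\<integral>\<^sup>+x. h (v x) * indicator (hbox b) x \<partial>lborel) = (\<integral>\<^sup>+x. h (w x) * indicator (hbox b) x \<partial>lborel)"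
        using ae' by (intro nn_integral_cong_AE) (auto elim!: eventually_mono)
      then show ?thesis by (simp add: average_def set_lebesgue_integral_eq_lborel)
    qed
    note avg = this[of ennreal] this[of "\<lambda>t. ennreal_power (ennreal t) (1 - p / (p - 1))"]
    show "(\<integral>\<^sup>+x. ennreal (v x) * indicator (hbox b) x \<partial>lborel) / emeasure lborel (hbox b) *
      ennreal_power ((\<integral>\<^sup>+x. ennreal_power (ennreal (v x)) (1 - p / (p - 1)) * indicator (hbox b) x \<partial>lborel)
        / emeasure lborel (hbox b)) (p - 1) \<le> ennreal k"
      unfolding avg k(2)[symmetric] K_def using hbox_rectangle[OF b] by (rule SUP_upper)
  qed
qed

lemma countable_family_bound:
  assumes N: "sets N = sets borel" and "countable P"
    and bound: "\<And>Q. finite Q \<Longrightarrow> Q \<subseteq> P \<Longrightarrow> emeasure N (\<Union>p\<in>Q. hbox p) \<le> B"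
  shows "emeasure N (\<Union>p\<in>P. hbox p) \<le> B"
proof (cases "P = {}")
  case False
  define F where "F m = (\<Union>p\<in>from_nat_into P ` {..m}. hbox p)" for m :: nat
  have "(\<Union>m. F m) = (\<Union>m. hbox (from_nat_into P m))"
    unfolding F_def by blast
  also have "\<dots> = (\<Union>p\<in>range (from_nat_into P). hbox p)" by simp
  also have "range (from_nat_into P) = P" using False assms(2) by simp
  finally have UF: "(\<Union>m. F m) = (\<Union>p\<in>P. hbox p)" .
  have "incseq F" unfolding F_def by (intro incseq_SucI UN_mono) auto
  moreover have "F m \<in> sets N" for m unfolding F_def N by (rule UN_hbox_measurable) simp
  ultimately have "(SUP m. emeasure N (F m)) = emeasure N (\<Union>m. F m)"
    by (intro SUP_emeasure_incseq) auto
  moreover have "emeasure N (F m) \<le> B" for m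
    unfolding F_def using from_nat_into[OF False] by (intro bound) auto
  ultimately show ?thesis unfolding UF by (metis SUP_least)
qed simp

text \<open>Stated for arbitrary sets: the superlevel set is only ever enclosed in a countable union
  of boxes.\<close>

lemma weighted_measure_mono: "A \<subseteq> B \<Longrightarrow> weighted_measure w A \<le> weighted_measure w B"
  unfolding weighted_measure_def by (intro nn_integral_mono) (auto simp: indicator_def)

theorem mainTheorem1:
  fixes w :: "real ^ 'n \<Rightarrow> real"
  assumes "w \<in> strong_A_infinity"
  shows "\<exists>C::real. C > 0 \<and>
    (\<forall>f :: real ^ 'n \<Rightarrow> real. \<forall>l::real. locally_integrable f \<longrightarrow> l > 0 \<longrightarrow>
      weighted_measure w {x. strong_maximal f x > ennreal l}
      \<le> ennreal C *
        (\<integral>\<^sup>+ x. ennreal (\<bar>f x\<bar> / l * (1 + log_plus (\<bar>f x\<bar> / l) ^ (CARD('n) - 1)))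
                * strong_maximal w x \<partial>lebesgue))"
proof -
  obtain p where p: "p > 1" "w \<in> strong_A p" using assms by (auto simp: strong_A_infinity_def)
  have w: "\<And>x. 0 \<le> w x" "locally_integrable w" using p(2) by (auto simp: strong_A_def weight_def)
  obtain v where v [measurable]: "v \<in> borel_measurable borel" and v0: "\<And>x. 0 \<le> v x"
    and ae_v: "AE x in lborel. \<bar>w x\<bar> = v x"
    using locally_integrable_borel_version[OF w(2)] by blast
  define N where "N = density lborel (\<lambda>x. ennreal (v x))"
  have ainf: "ainf N" unfolding N_def by (rule strong_A_ainf[OF p(2,1) v v0 ae_v])
  have setsN: "sets N = sets borel" by (simp add: N_def)
  have N: "emeasure N E = (\<integral>\<^sup>+x. ennreal \<bar>w x\<bar> * indicator E x \<partial>lborel)" if "E \<in> sets borel" for E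
  proof -
    have "emeasure N E = (\<integral>\<^sup>+x. ennreal (v x) * indicator E x \<partial>lborel)"
      unfolding N_def using that by (subst emeasure_density) auto
    also have "\<dots> = (\<integral>\<^sup>+x. ennreal \<bar>w x\<bar> * indicator E x \<partial>lborel)"
      using ae_v by (intro nn_integral_cong_AE) (auto elim!: eventually_mono)
    finally show ?thesis .
  qed
  define d where "d = CARD('n) - 1"
  obtain C where "C \<ge> 0" and C: "\<And>P g. finite P \<Longrightarrow> (\<forall>p\<in>P. proper p) \<Longrightarrow> g \<in> borel_measurable borel \<Longrightarrow> (\<forall>x. 0 \<le> g x) \<Longrightarrow>
    (\<forall>p\<in>P. emeasure lborel (hbox p) \<le> (\<integral>\<^sup>+x. ennreal (g x) * indicator (hbox p) x \<partial>lborel)) \<Longrightarrow>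
    emeasure N (\<Union>p\<in>P. hbox p) \<le> ennreal C * (\<integral>\<^sup>+x. ennreal (g x * Llog (g x) ^ d) *
      (SUP p\<in>P. indicator (hbox p) x * (emeasure N (hbox p) / emeasure lborel (hbox p))) \<partial>lborel)"
    using finite_family_bound[OF ainf] unfolding d_def by blast
  \<comment> \<open>\<open>2 ^ d\<close> pays for passing from \<open>Llog\<close> to
    \<open>log_plus\<close>, and the added 1 keeps the constant positive.\<close>
  define C' where "C' = (C + 1) * 2 ^ d"
  have "C' > 0" using \<open>C \<ge> 0\<close> by (simp add: C'_def)
  moreover have "weighted_measure w {x. strong_maximal f x > ennreal l}
      \<le> ennreal C' * (\<integral>\<^sup>+ x. ennreal (\<bar>f x\<bar> / l * (1 + log_plus (\<bar>f x\<bar> / l) ^ d)) * strong_maximal w x \<partial>lebesgue)"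
    if f: "locally_integrable f" and l: "l > 0" for f l
  proof -
    obtain g0 where g0 [measurable]: "g0 \<in> borel_measurable borel" and g0_nonneg: "\<And>x. 0 \<le> g0 x"
      and ae_g: "AE x in lborel. \<bar>f x\<bar> = g0 x"
      using locally_integrable_borel_version[OF f] by blast
    define g where "g x = g0 x / l" for x
    have g [measurable]: "g \<in> borel_measurable borel" unfolding g_def by measurable
    have gnn: "0 \<le> g x" for x using g0_nonneg l by (simp add: g_def)
    define P where "P = {b \<in> rational_corners. proper b \<and>
      emeasure lborel (hbox b) \<le> (\<integral>\<^sup>+x. ennreal (g x) * indicator (hbox b) x \<partial>lborel)}"
    have cP: "countable P" unfolding P_def by (rule countable_subset[OF _ countable_rational_corners]) auto
    define I where "I = (\<integral>\<^sup>+x. ennreal (\<bar>f x\<bar> / l * (1 + log_plus (\<bar>f x\<bar> / l) ^ d)) * strong_maximal w x \<partial>lborel)"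
    have bound: "emeasure N (\<Union>p\<in>Q. hbox p) \<le> ennreal C' * I" if Q: "finite Q" "Q \<subseteq> P" for Q
    proof -
      define M where "M x = (SUP p\<in>Q. indicator (hbox p) x * (emeasure N (hbox p) / emeasure lborel (hbox p)))" for x
      have [measurable]: "M \<in> borel_measurable borel"
        unfolding M_def[abs_def] using Q(1) by (intro borel_measurable_SUP countable_finite) measurable
      \<comment> \<open>Each ratio is the average of w over a rectangle containing \<open>x\<close>,
        hence a competitor in the supremum.\<close>
      have M_le: "M x \<le> strong_maximal w x" for x
        unfolding M_def
      proof (rule SUP_least)
        fix b assume "b \<in> Q"
        then have "proper b" using Q(2) by (auto simp: P_def)
        then show "indicator (hbox b) x * (emeasure N (hbox b) / emeasure lborel (hbox b)) \<le> strong_maximal w x"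
          using strong_maximal_ge[of b x w] by (cases "x \<in> hbox b") (simp_all add: N)
      qed
      have "emeasure N (\<Union>p\<in>Q. hbox p) \<le> ennreal C * (\<integral>\<^sup>+x. ennreal (g x * Llog (g x) ^ d) * M x \<partial>lborel)"
        unfolding M_def using Q gnn by (intro C) (auto simp: P_def)
      also have "(\<integral>\<^sup>+x. ennreal (g x * Llog (g x) ^ d) * M x \<partial>lborel)
        = ennreal (2 ^ d) * (\<integral>\<^sup>+x. ennreal (g x * Llog (g x) ^ d / 2 ^ d) * M x \<partial>lborel)"
      proof -
        have "ennreal (g x * Llog (g x) ^ d) = ennreal (2 ^ d) * ennreal (g x * Llog (g x) ^ d / 2 ^ d)" for x
          using gnn[of x] Llog_ge_1[of "g x"] by (subst ennreal_mult[symmetric]) auto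
        then show ?thesis by (simp add: nn_integral_cmult mult.assoc del: ennreal_power)
      qed
      also have "(\<integral>\<^sup>+x. ennreal (g x * Llog (g x) ^ d / 2 ^ d) * M x \<partial>lborel) \<le> I"
        unfolding I_def
      proof (rule nn_integral_mono_AE)
        show "AE x in lborel. ennreal (g x * Llog (g x) ^ d / 2 ^ d) * M x
          \<le> ennreal (\<bar>f x\<bar> / l * (1 + log_plus (\<bar>f x\<bar> / l) ^ d)) * strong_maximal w x"
          using ae_g
        proof (rule eventually_mono)
          fix x assume "\<bar>f x\<bar> = g0 x"
          then have fg: "\<bar>f x\<bar> / l = g x" by (simp add: g_def)
          have "Llog (g x) ^ d / 2 ^ d \<le> 1 + log_plus (g x) ^ d"
            using Llog_power_le[of "g x" d] by (simp add: field_simps)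
          then have "g x * (Llog (g x) ^ d / 2 ^ d) \<le> g x * (1 + log_plus (g x) ^ d)"
            using gnn by (rule mult_left_mono)
          then show "ennreal (g x * Llog (g x) ^ d / 2 ^ d) * M x
            \<le> ennreal (\<bar>f x\<bar> / l * (1 + log_plus (\<bar>f x\<bar> / l) ^ d)) * strong_maximal w x"
            unfolding fg by (intro mult_mono M_le ennreal_leI) auto
        qed
      qed
      finally have "emeasure N (\<Union>p\<in>Q. hbox p) \<le> ennreal C * (ennreal (2 ^ d) * I)"
        by (simp add: mult_left_mono)
      also have "\<dots> = ennreal (C * 2 ^ d) * I" using \<open>C \<ge> 0\<close> by (simp add: ennreal_mult mult.assoc)
      also have "\<dots> \<le> ennreal C' * I"
        by (intro mult_right_mono ennreal_leI) (auto simp: C'_def)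
      finally show ?thesis .
    qed
    have "{x. strong_maximal f x > ennreal l} \<subseteq> (\<Union>p\<in>P. hbox p)"
    proof
      fix x assume "x \<in> {x. strong_maximal f x > ennreal l}"
      then obtain b where b: "b \<in> rational_corners" "proper b" "x \<in> hbox b"
        "ennreal l * emeasure lborel (hbox b) \<le> (\<integral>\<^sup>+x. ennreal (g0 x) * indicator (hbox b) x \<partial>lborel)"
        using strong_maximal_cover[OF l ae_g] by blast
      have g0g: "ennreal (g0 x) = ennreal l * ennreal (g x)" for x
        using l gnn[of x] by (simp add: g_def ennreal_mult[symmetric])
      have "ennreal l * emeasure lborel (hbox b) \<le> ennreal l * (\<integral>\<^sup>+x. ennreal (g x) * indicator (hbox b) x \<partial>lborel)"
        using b(4) by (simp add: g0g nn_integral_cmult mult.assoc)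
      then have "ennreal (1 / l) * (ennreal l * emeasure lborel (hbox b)) \<le> ennreal (1 / l) * (ennreal l * (\<integral>\<^sup>+x. ennreal (g x) * indicator (hbox b) x \<partial>lborel))"
        by (rule mult_left_mono) simp
      then have "emeasure lborel (hbox b) \<le> (\<integral>\<^sup>+x. ennreal (g x) * indicator (hbox b) x \<partial>lborel)"
        using l by (simp add: mult.assoc[symmetric] ennreal_mult[symmetric])
      then have "b \<in> P" using b by (simp add: P_def)
      then show "x \<in> (\<Union>p\<in>P. hbox p)" using b(3) by (rule UN_I)
    qed
    then have "weighted_measure w {x. strong_maximal f x > ennreal l} \<le> weighted_measure w (\<Union>p\<in>P. hbox p)"
      by (rule weighted_measure_mono)
    also have "\<dots> = emeasure N (\<Union>p\<in>P. hbox p)"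
    proof -
      have "(\<Union>p\<in>P. hbox p) \<in> sets borel" using cP by (intro sets.countable_UN') auto
      then show ?thesis using w(1) by (simp add: N weighted_measure_def set_lebesgue_integral_eq_lborel)
    qed
    also have "\<dots> \<le> ennreal C' * I"
      by (rule countable_family_bound[OF setsN cP bound])
    also have "I = (\<integral>\<^sup>+ x. ennreal (\<bar>f x\<bar> / l * (1 + log_plus (\<bar>f x\<bar> / l) ^ d)) * strong_maximal w x \<partial>lebesgue)"
      unfolding I_def by (rule nn_integral_completion[symmetric])
    finally show ?thesis .
  qed
  ultimately show ?thesis unfolding d_def by blast
qed

end
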